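(* Let $X$ be a locally compact Hausdorff space with Borel $\sigma$-algebra $\Omega$, $E$ a Banach lattice, and $\pi\colon C_0(X)\to\mathcal L_{\mathrm r}(E)$ a positive representation. Suppose $\pi$ has a generating regular positive spectral measure $P$ on $\Omega$. (1) Let $V$ be an open subset of $X$. Then, in $\mathcal L_{\mathrm r}(E)$, $P(V)=\sup\{\pi(\phi):\phi\in C_{\mathrm c}(X),\ \operatorname{supp}\phi\subset V,\ 0\leq\phi\leq\mathbf 1_X\}$. (2) Let $K$ be a compact subset of $X$. Then, in $\mathcal L_{\mathrm r}(E)$, $P(K)=\inf\{\pi(\phi):\phi\in C_{\mathrm c}(X),\ \phi\geq\chi_K\}$. (3) In addition to the expression for $P(X)$ obtained from part (1), we also have, in $\mathcal L_{\mathrm r}(E)$, $P(X)=\sup\{\pi(\phi):\phi\in C_0(X),\ 0\leq\phi\leq\mathbf 1_X\}$. (4) Let $V$ be an open subset of $X$. Then $V$ is $\sigma$-compact if and only if there exists a sequence $(\phi_n)_{n=1}^\infty$ in $C_{\mathrm c}(X)$ such that $\operatorname{supp}\phi_n\subset V$ ($n\geq1$) and $\sup_n\phi_n=\chi_V$ in $\mathcal B(X)$. In that case, there exists a sequence $(\phi_n)_{n=1}^\infty$ in $C_{\mathrm c}(X)$ such that $\operatorname{supp}\phi_n\subset V$ and $0\leq\phi_n\leq\mathbf 1_X$ ($n\geq1$), and $\phi_n\uparrow\chi_V$ in $\mathcal B(X)$. For any norm bounded sequence $(\phi_n)_{n=1}^\infty$ in $C_{\mathrm c}(X)$ such that $\phi_n\uparrow\chi_V$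 in $\mathcal B(X)$, we have $\pi(\phi_n)\uparrow P(V)$ in $\mathcal L_{\mathrm r}(E)$ and $P(V)=\mathrm{WOT\text{-}}\lim_n\pi(\phi_n)$. (5) $X$ is $\sigma$-compact if and only if there exists a sequence $(\phi_n)_{n=1}^\infty$ in $C_0(X)$ such that $0\leq\phi_n\leq\mathbf 1_X$ ($n\geq1$) and $\sup_n\phi_n=\mathbf 1_X$ in $\mathcal B(X)$. In that case, there exists a sequence $(\phi_n)_{n=1}^\infty$ in $C_{\mathrm c}(X)$ such that $0\leq\phi_n\leq\mathbf 1_X$ ($n\geq1$) and $\phi_n\uparrow\mathbf 1_X$ in $\mathcal B(X)$. For any norm bounded sequence $(\phi_n)_{n=1}^\infty$ in $C_0(X)$ such that $\phi_n\uparrow\mathbf 1_X$ in $\mathcal B(X)$, we have $\pi(\phi_n)\uparrow P(X)$ in $\mathcal L_{\mathrm r}(E)$ and $P(X)=\mathrm{WOT\text{-}}\lim_n\pi(\phi_n)$.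
   Context: All vector spaces are real. $C_{\mathrm c}(X)$ and $C_0(X)$ are the real-valued continuous functions on $X$ with compact support, resp. vanishing at infinity; $\mathcal B(X)$ is the Banach lattice algebra of bounded Borel measurable real-valued functions on $X$ (supremum norm, pointwise operations). $\mathbf 1_X$ is the constant function $1$ and $\chi_S$ is the characteristic function of $S$. A subset is $\sigma$-compact if it is a countable union of compact subsets of $X$. In an ordered vector space, $v_n\uparrow v$ means $v_n\leq v_{n+1}$ for all $n$ and $v=\sup_nv_n$. In $\mathcal B(X)$ one has $\phi_n\uparrow\phi$ iff $\phi_n(\xi)\uparrow\phi(\xi)$ for all $\xi\in X$. $\mathcal L(E)$ denotes the bounded linear operators on $E$, and $\mathcal L_{\mathrm r}(E)\subset\mathcal L(E)$ the regular operators (differences of two positive linear operators) with the usual operator ordering. $E$ is not assumed Dedekind complete; existence of the suprema and infima in $\mathcal L_{\mathrm r}(E)$ is part of the assertion. $\mathrm{WOT\text{-}}\lim$ is the limit in the weak operator topology. A positive representation of an ordered algebra $A$ on $E$ is an algebra homomorphism $\pi\colon A\to\mathcal L(E)$ with $\pi(a)$ a positive operator for every $a\geq0$; it need not be bounded or unital. A positive spectral measure on $\Omega$ is a map $P\colon\Omega\to\mathcal L_{\mathrm r}(E)$ such that: each $P(\Delta)$ is a positive projection; $P(\emptyset)=0$; $P(\Delta_1\cap\Delta_2)=P(\Delta_1)P(\Delta_2)$ for all $\Delta_1,\Delta_2\in\Omega$; and for pairwise disjoint $\Delta_n\in\Omega$ ($n\geq1$) and $x\in E$ one has $P(\bigcup_n\Delta_n)x=\sum_nP(\Delta_n)x$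 with norm convergence. ($P(X)$ need not be the identity.) For $x\in E$ and $x'$ in the norm dual $E'$, put $\mu_{x,x'}(\Delta)=\langle P(\Delta)x,x'\rangle$. $P$ is regular if every $\mu_{x,x'}$ is a regular finite signed Borel measure, i.e. a difference of two finite positive measures on $\Omega$ that are outer regular (by open sets) on all Borel sets and inner regular (by compact sets) on all open sets. The representation generated by $P$ is the unique bounded linear map $\pi_P\colon\mathcal B(X)\to(\mathcal L(E),\|\cdot\|)$ with $\pi_P(\chi_\Delta)=P(\Delta)$ for all $\Delta\in\Omega$; it is a positive representation with values in $\mathcal L_{\mathrm r}(E)$, and $\langle\pi_P(\phi)x,x'\rangle=\int_X\phi\,d\mu_{x,x'}$. $P$ generates $\pi\colon C_0(X)\to\mathcal L_{\mathrm r}(E)$ if $\pi$ is the restriction of $\pi_P$ to $C_0(X)$. *)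

theory Defs
  imports "HOL-Analysis.Analysis"
begin

section \<open>Banach lattices and their operators\<close>

class banach_lattice = banach + ordered_real_vector + lattice +
  assumes lattice_norm_mono: "sup x (- x) \<le> sup y (- y) \<Longrightarrow> norm x \<le> norm y"

instance real :: banach_lattice
  by standard (auto simp: sup_max max_def split: if_splits)

definition positive_operator :: "('e::banach_lattice \<Rightarrow> 'f::banach_lattice) \<Rightarrow> bool" where
  "positive_operator T \<longleftrightarrow> linear T \<and> (\<forall>x\<ge>0. 0 \<le> T x)"

text \<open>Positive linear operators between Banach lattices are automatically bounded, so the two
  summands are not required to be bounded.\<close>

definition regular_operators :: "('e::banach_lattice \<Rightarrow>\<^sub>L 'e) set" where
  "regular_operators =
     {T. \<exists>S1 S2 :: 'e \<Rightarrow> 'e. positive_operator S1 \<and> positive_operator S2 \<and>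
           (\<forall>x. blinfun_apply T x = S1 x - S2 x)}"

definition operator_le :: "('e::banach_lattice \<Rightarrow>\<^sub>L 'e) \<Rightarrow> ('e \<Rightarrow>\<^sub>L 'e) \<Rightarrow> bool" where
  "operator_le S T \<longleftrightarrow> positive_operator (blinfun_apply (T - S))"

definition weak_operator_topology ::
  "('e::real_normed_vector \<Rightarrow>\<^sub>L 'f::real_normed_vector) topology" where
  "weak_operator_topology =
     pullback_topology UNIV
       (\<lambda>T (x, x'). blinfun_apply (x' :: 'f \<Rightarrow>\<^sub>L real) (blinfun_apply T x)) euclidean"

section \<open>Suprema and infima relative to a carrier\<close>

definition is_sup_in :: "('b \<Rightarrow> 'b \<Rightarrow> bool) \<Rightarrow> 'b set \<Rightarrow> 'b set \<Rightarrow> 'b \<Rightarrow> bool" where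
  "is_sup_in le A S s \<longleftrightarrow>
     s \<in> A \<and> (\<forall>t\<in>S. le t s) \<and> (\<forall>u\<in>A. (\<forall>t\<in>S. le t u) \<longrightarrow> le s u)"

definition is_inf_in :: "('b \<Rightarrow> 'b \<Rightarrow> bool) \<Rightarrow> 'b set \<Rightarrow> 'b set \<Rightarrow> 'b \<Rightarrow> bool" where
  "is_inf_in le A S s \<longleftrightarrow>
     s \<in> A \<and> (\<forall>t\<in>S. le s t) \<and> (\<forall>u\<in>A. (\<forall>t\<in>S. le u t) \<longrightarrow> le u s)"

definition increases_to_in :: "('b \<Rightarrow> 'b \<Rightarrow> bool) \<Rightarrow> 'b set \<Rightarrow> (nat \<Rightarrow> 'b) \<Rightarrow> 'b \<Rightarrow> bool" where
  "increases_to_in le A v s \<longleftrightarrow> (\<forall>n. le (v n) (v (Suc n))) \<and> is_sup_in le A (range v) s"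

section \<open>Function spaces\<close>

definition tsupp :: "('a::topological_space \<Rightarrow> real) \<Rightarrow> 'a set" where
  "tsupp \<phi> = closure {x. \<phi> x \<noteq> 0}"

definition Cc :: "('a::topological_space \<Rightarrow> real) set" where
  "Cc = {\<phi>. continuous_on UNIV \<phi> \<and> compact (tsupp \<phi>)}"

definition C0 :: "('a::topological_space \<Rightarrow> real) set" where
  "C0 = {\<phi>. continuous_on UNIV \<phi> \<and> (\<forall>e>0. compact {x. e \<le> \<bar>\<phi> x\<bar>})}"

definition bounded_borel :: "('a::topological_space \<Rightarrow> real) set" where
  "bounded_borel = {\<phi> \<in> borel_measurable borel. bounded (range \<phi>)}"

definition sup_norm :: "('a \<Rightarrow> real) \<Rightarrow> real" where
  "sup_norm \<phi> = (SUP x. \<bar>\<phi> x\<bar>)"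

definition norm_bounded_seq :: "(nat \<Rightarrow> 'a \<Rightarrow> real) \<Rightarrow> bool" where
  "norm_bounded_seq \<phi> \<longleftrightarrow> (\<exists>M. \<forall>n. sup_norm (\<phi> n) \<le> M)"

definition sigma_compact :: "'a::topological_space set \<Rightarrow> bool" where
  "sigma_compact S \<longleftrightarrow> (\<exists>K :: nat \<Rightarrow> 'a set. (\<forall>n. compact (K n)) \<and> S = (\<Union>n. K n))"

section \<open>Positive representations and spectral measures\<close>

definition linear_map_on :: "('a \<Rightarrow> real) set \<Rightarrow> (('a \<Rightarrow> real) \<Rightarrow> 'b::real_vector) \<Rightarrow> bool" where
  "linear_map_on A \<pi> \<longleftrightarrow>
     (\<forall>\<phi>\<in>A. \<forall>\<psi>\<in>A. \<pi> (\<lambda>x. \<phi> x + \<psi> x) = \<pi> \<phi> + \<pi> \<psi>) \<and>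
     (\<forall>\<phi>\<in>A. \<forall>c. \<pi> (\<lambda>x. c * \<phi> x) = c *\<^sub>R \<pi> \<phi>)"

definition positive_representation ::
  "('a \<Rightarrow> real) set \<Rightarrow> (('a \<Rightarrow> real) \<Rightarrow> 'e::banach_lattice \<Rightarrow>\<^sub>L 'e) \<Rightarrow> bool" where
  "positive_representation A \<pi> \<longleftrightarrow>
     linear_map_on A \<pi> \<and>
     (\<forall>\<phi>\<in>A. \<forall>\<psi>\<in>A. \<pi> (\<lambda>x. \<phi> x * \<psi> x) = \<pi> \<phi> o\<^sub>L \<pi> \<psi>) \<and>
     (\<forall>\<phi>\<in>A. (\<forall>x. 0 \<le> \<phi> x) \<longrightarrow> positive_operator (blinfun_apply (\<pi> \<phi>)))"

text \<open>Set functions on the Borel \<open>\<sigma>\<close>-algebra are total functions on sets; their values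
  off \<open>sets borel\<close> are irrelevant.\<close>

definition positive_spectral_measure ::
  "('a::topological_space set \<Rightarrow> 'e::banach_lattice \<Rightarrow>\<^sub>L 'e) \<Rightarrow> bool" where
  "positive_spectral_measure P \<longleftrightarrow>
     (\<forall>D\<in>sets borel. positive_operator (blinfun_apply (P D)) \<and> P D o\<^sub>L P D = P D) \<and>
     P {} = 0 \<and>
     (\<forall>D1\<in>sets borel. \<forall>D2\<in>sets borel. P (D1 \<inter> D2) = P D1 o\<^sub>L P D2) \<and>
     (\<forall>D :: nat \<Rightarrow> 'a set. range D \<subseteq> sets borel \<longrightarrow> disjoint_family D \<longrightarrow>
        (\<forall>x. (\<lambda>n. blinfun_apply (P (D n)) x) sums blinfun_apply (P (\<Union>n. D n)) x))"

definition regular_finite_borel_measure :: "'a::topological_space measure \<Rightarrow> bool" where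
  "regular_finite_borel_measure M \<longleftrightarrow>
     finite_measure M \<and> sets M = sets borel \<and>
     (\<forall>B\<in>sets borel. emeasure M B = (INF U\<in>{U. open U \<and> B \<subseteq> U}. emeasure M U)) \<and>
     (\<forall>U. open U \<longrightarrow> emeasure M U = (SUP K\<in>{K. compact K \<and> K \<subseteq> U}. emeasure M K))"

definition regular_finite_signed_borel_measure :: "('a::topological_space set \<Rightarrow> real) \<Rightarrow> bool" where
  "regular_finite_signed_borel_measure \<mu> \<longleftrightarrow>
     (\<exists>M N. regular_finite_borel_measure M \<and> regular_finite_borel_measure N \<and>
        (\<forall>D\<in>sets borel. \<mu> D = measure M D - measure N D))"

definition regular_positive_spectral_measure ::
  "('a::topological_space set \<Rightarrow> 'e::banach_lattice \<Rightarrow>\<^sub>L 'e) \<Rightarrow> bool" where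
  "regular_positive_spectral_measure P \<longleftrightarrow>
     positive_spectral_measure P \<and>
     (\<forall>x. \<forall>x' :: 'e \<Rightarrow>\<^sub>L real.
        regular_finite_signed_borel_measure (\<lambda>D. blinfun_apply x' (blinfun_apply (P D) x)))"

text \<open>The bounded linear map extending \<open>P\<close> exists, and it is unique on \<open>bounded_borel\<close>, because
  the linear span of the Borel indicator functions is dense there for the supremum norm. It is a
  predicate, not a function of \<open>P\<close>, because values off \<open>bounded_borel\<close> are arbitrary.\<close>

definition generated_representation ::
  "('a::topological_space set \<Rightarrow> 'e::banach_lattice \<Rightarrow>\<^sub>L 'e) \<Rightarrow>
   (('a \<Rightarrow> real) \<Rightarrow> 'e \<Rightarrow>\<^sub>L 'e) \<Rightarrow> bool" where
  "generated_representation P \<rho> \<longleftrightarrow>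
     linear_map_on bounded_borel \<rho> \<and>
     (\<exists>C. \<forall>\<phi>\<in>bounded_borel. norm (\<rho> \<phi>) \<le> C * sup_norm \<phi>) \<and>
     (\<forall>D\<in>sets borel. \<rho> (indicat_real D) = P D)"

definition generates ::
  "('a::topological_space set \<Rightarrow> 'e::banach_lattice \<Rightarrow>\<^sub>L 'e) \<Rightarrow>
   (('a \<Rightarrow> real) \<Rightarrow> 'e \<Rightarrow>\<^sub>L 'e) \<Rightarrow> bool" where
  "generates P \<pi> \<longleftrightarrow> (\<exists>\<rho>. generated_representation P \<rho> \<and> (\<forall>\<phi>\<in>C0. \<pi> \<phi> = \<rho> \<phi>))"

end

(*
  A positive operator inequality can be tested on positive vectors and positive functionals: by
  Hahn-Banach applied to z |-> norm (sup z 0), the positive functionals determine the order of a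
  Banach lattice.  Since the generated representation is monotone on bounded Borel functions,
  Urysohn's lemma gives P K <= pi phi <= P V whenever indicator K <= phi <= indicator V, and the
  regularity of the measures D |-> x'(P D x) makes x'(P V x) - x'(P K x) arbitrarily small.  So (1)-(3)
  need no integration.  In (4) and (5), for phi_n increasing to indicator V and x >= 0, the positive
  function psi_n = indicator V - phi_n is bounded by a constant on A_n = {psi_n >= e} and by e elsewhere;
  as A_n decreases to the empty set, P (A_n) x tends to 0, and pi (phi_n) converges to P V even in the
  strong operator topology.
*)

theory Submission
  imports Defs
begin

text \<open>The competing bounds are arbitrary regular operators on a lattice that need not be
  Dedekind complete, so a supremum cannot be constructed: \<open>P V\<close> itself has to be
  compared with every upper bound \<open>u\<close>. Regularity yields only scalar estimates, and the
  compact set depends on the vector, the functional and the error, so one function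
  \<open>\<phi>\<close> is not expected to serve all of them. This does no harm because each chain
  \<open>P K z \<le> \<rho> \<phi> z \<le> u z\<close> ends in a term free of these choices.
  Monotonicity of \<open>\<rho>\<close> is not part of its definition; it comes from positivity of
  the values of \<open>P\<close> through nonnegative step functions and the norm bound. For
  sequences, countable additivity in norm takes the place of the scalar measures, and the lattice
  norm turns order domination into norm estimates.\<close>

section \<open>The Hahn--Banach theorem\<close>

text \<open>Homogeneity for positive scalars is stated as an inequality; replacing \<open>t\<close> by
  \<open>1 / t\<close> gives the equation, and \<open>p 0 = 0\<close>.\<close>

definition sublinear :: "('v::real_vector \<Rightarrow> real) \<Rightarrow> bool" where
  "sublinear p \<longleftrightarrow> (\<forall>x y. p (x + y) \<le> p x + p y) \<and> (\<forall>t>0. \<forall>x. p (t *\<^sub>R x) \<le> t * p x)"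

lemma sublinear_add: "sublinear p \<Longrightarrow> p (x + y) \<le> p x + p y"
  by (simp add: sublinear_def)

lemma sublinear_scaleR:
  assumes "sublinear p" "0 < t"
  shows "p (t *\<^sub>R x) = t * p x"
proof (rule antisym)
  have "p ((1 / t) *\<^sub>R (t *\<^sub>R x)) \<le> (1 / t) * p (t *\<^sub>R x)"
    using assms unfolding sublinear_def by (metis zero_less_divide_1_iff)
  then show "t * p x \<le> p (t *\<^sub>R x)"
    using assms by (simp add: field_simps)
qed (use assms in \<open>simp add: sublinear_def\<close>)

lemma sublinear_0: "sublinear p \<Longrightarrow> p 0 = 0"
  using sublinear_scaleR[of p 2 0] by simp

lemma sublinear_minus: "sublinear p \<Longrightarrow> - p (- x) \<le> p x"
  using sublinear_add[of p x "- x"] sublinear_0[of p] by simp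

text \<open>For sublinear \<open>p\<close> this is the largest sublinear functional below
  \<open>p\<close> whose value at \<open>- a\<close> is at most \<open>- p a\<close>. It is used
  twice: to prescribe the value of the final functional at \<open>a\<close>, and to show that a
  minimal sublinear functional is additive.\<close>

definition sublinear_shift :: "('v::real_vector \<Rightarrow> real) \<Rightarrow> 'v \<Rightarrow> 'v \<Rightarrow> real" where
  "sublinear_shift p a x = (INF t\<in>{0..}. p (x + t *\<^sub>R a) - t * p a)"

lemma sublinear_shift_le:
  assumes "sublinear p" "0 \<le> t"
  shows "sublinear_shift p a x \<le> p (x + t *\<^sub>R a) - t * p a"
  unfolding sublinear_shift_def
proof (rule cINF_lower)
  show "bdd_below ((\<lambda>t. p (x + t *\<^sub>R a) - t * p a) ` {0..})"
  \<comment> \<open>Splitting \<open>t *\<^sub>R a\<close> as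
    \<open>(x + t *\<^sub>R a) + (- x)\<close> gives a lower bound independent of \<open>t\<close>,
    so the infimum is a genuine one.\<close>
  proof (rule bdd_belowI2[where m = "- p (- x)"])
    fix t :: real assume "t \<in> {0..}"
    then have "t * p a = p (t *\<^sub>R a)"
      using sublinear_scaleR[OF assms(1), of t a] sublinear_0[OF assms(1)] by (cases "t = 0") auto
    also have "\<dots> \<le> p (x + t *\<^sub>R a) + p (- x)"
      using sublinear_add[OF assms(1), of "x + t *\<^sub>R a" "- x"] by simp
    finally show "- p (- x) \<le> p (x + t *\<^sub>R a) - t * p a" by simp
  qed
qed (use assms in auto)

lemma sublinear_shift_greatest:
  assumes "\<And>t. 0 \<le> t \<Longrightarrow> c \<le> p (x + t *\<^sub>R a) - t * p a"
  shows "c \<le> sublinear_shift p a x"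
  unfolding sublinear_shift_def by (rule cINF_greatest) (use assms in auto)

lemma sublinear_sublinear_shift:
  assumes p: "sublinear p"
  shows "sublinear (sublinear_shift p a)"
  unfolding sublinear_def
proof (intro conjI allI impI)
  fix x y
  \<comment> \<open>Parameters \<open>s\<close> for \<open>x\<close> and \<open>t\<close> for
    \<open>y\<close> combine to \<open>s + t\<close> for \<open>x + y\<close>. The two infima are
    taken one after the other: here over \<open>t\<close> with \<open>s\<close> fixed, afterwards
    over \<open>s\<close>.\<close>
  have "sublinear_shift p a (x + y) - (p (x + s *\<^sub>R a) - s * p a) \<le> sublinear_shift p a y"
    if s: "0 \<le> s" for s
  proof (rule sublinear_shift_greatest)
    fix t :: real assume t: "0 \<le> t"
    have "sublinear_shift p a (x + y) \<le> p (x + y + (s + t) *\<^sub>R a) - (s + t) * p a"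
      using s t by (intro sublinear_shift_le[OF p]) simp
    moreover have "p (x + y + (s + t) *\<^sub>R a) \<le> p (x + s *\<^sub>R a) + p (y + t *\<^sub>R a)"
      using sublinear_add[OF p, of "x + s *\<^sub>R a" "y + t *\<^sub>R a"] by (simp add: algebra_simps)
    ultimately show "sublinear_shift p a (x + y) - (p (x + s *\<^sub>R a) - s * p a)
        \<le> p (y + t *\<^sub>R a) - t * p a"
      by (simp add: algebra_simps)
  qed
  then have "sublinear_shift p a (x + y) - sublinear_shift p a y \<le> sublinear_shift p a x"
    by (intro sublinear_shift_greatest) (simp add: algebra_simps)
  then show "sublinear_shift p a (x + y) \<le> sublinear_shift p a x + sublinear_shift p a y"
    by simp
next
  fix c :: real and x assume c: "0 < c"
  have "sublinear_shift p a (c *\<^sub>R x) / c \<le> sublinear_shift p a x"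
  proof (rule sublinear_shift_greatest)
    fix t :: real assume t: "0 \<le> t"
    have "sublinear_shift p a (c *\<^sub>R x) \<le> p (c *\<^sub>R x + (c * t) *\<^sub>R a) - (c * t) * p a"
      using c t by (intro sublinear_shift_le[OF p]) simp
    also have "p (c *\<^sub>R x + (c * t) *\<^sub>R a) = c * p (x + t *\<^sub>R a)"
      using sublinear_scaleR[OF p c, of "x + t *\<^sub>R a"] by (simp add: algebra_simps)
    finally show "sublinear_shift p a (c *\<^sub>R x) / c \<le> p (x + t *\<^sub>R a) - t * p a"
      using c by (simp add: field_simps)
  qed
  then show "sublinear_shift p a (c *\<^sub>R x) \<le> c * sublinear_shift p a x"
    using c by (simp add: field_simps)
qed

lemma minimal_sublinear_below:
  fixes p :: "'v::real_vector \<Rightarrow> real"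
  assumes p: "sublinear p"
  obtains q where "sublinear q" "q \<le> p" "\<And>r. sublinear r \<Longrightarrow> r \<le> q \<Longrightarrow> r = q"
proof -
  let ?A = "{q. sublinear q \<and> q \<le> p}"
  have "\<exists>m\<in>?A. \<forall>a\<in>?A. a \<le> m \<longrightarrow> a = m"
  \<comment> \<open>The order is reversed, so that the maximal element supplied by Zorn's lemma is a
    minimal functional.\<close>
  proof (rule predicate_Zorn[where P = "\<lambda>q r. r \<le> q"])
    show "partial_order_on ?A (relation_of (\<lambda>q r. r \<le> q) ?A)"
      by (rule partial_order_on_relation_ofI) auto
  next
    fix C assume "C \<in> Chains (relation_of (\<lambda>q r. r \<le> q) ?A)"
    then have C: "\<And>q. q \<in> C \<Longrightarrow> sublinear q \<and> q \<le> p"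
      "\<And>q r. q \<in> C \<Longrightarrow> r \<in> C \<Longrightarrow> q \<le> r \<or> r \<le> q"
      by (auto simp: Chains_def relation_of_def)
    show "\<exists>u\<in>?A. \<forall>a\<in>C. u \<le> a"
    \<comment> \<open>The pointwise infimum is meaningful only over a nonempty chain; the empty
      chain is bounded by \<open>p\<close>.\<close>
    proof (cases "C = {}")
      case True
      then show ?thesis using p by auto
    next
      case False
      define u where "u x = (INF q\<in>C. q x)" for x
      have lower: "u x \<le> q x" if "q \<in> C" for q x
        unfolding u_def
      proof (rule cINF_lower[OF _ that], rule bdd_belowI2[where m = "- p (- x)"])
        fix r assume "r \<in> C"
        then show "- p (- x) \<le> r x"
          using sublinear_minus[of r x] C(1)[of r] by (force simp: le_fun_def dest: spec[of _ "- x"])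
      qed
      have greatest: "c \<le> u x" if "\<And>q. q \<in> C \<Longrightarrow> c \<le> q x" for c x
        unfolding u_def by (rule cINF_greatest[OF False]) (use that in auto)
      have "sublinear u"
        unfolding sublinear_def
      proof (intro conjI allI impI)
        fix x y
        \<comment> \<open>Being a chain enters here: the smaller of \<open>q\<close> and
          \<open>r\<close> is a single sublinear functional that bounds both summands.\<close>
        have *: "u (x + y) \<le> q x + r y" if qr: "q \<in> C" "r \<in> C" for q r
        proof -
          obtain s where "s \<in> C" "s \<le> q" "s \<le> r"
            using C(2)[OF qr] qr by auto
          then show ?thesis
            using lower[of s "x + y"] sublinear_add[of s x y] C(1)[of s]
            by (smt (verit) le_funD)
        qed
        have "u (x + y) - q x \<le> u y" if "q \<in> C" for q
          using *[OF that] by (intro greatest) (simp add: algebra_simps)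
        then have "u (x + y) - u y \<le> u x"
          by (intro greatest) (simp add: algebra_simps)
        then show "u (x + y) \<le> u x + u y" by simp
      next
        fix t :: real and x assume t: "0 < t"
        have "u (t *\<^sub>R x) / t \<le> u x"
        proof (rule greatest)
          fix q assume "q \<in> C"
          then show "u (t *\<^sub>R x) / t \<le> q x"
            using lower[of q "t *\<^sub>R x"] C(1)[of q] sublinear_scaleR[of q t x] t
            by (simp add: field_simps)
        qed
        then show "u (t *\<^sub>R x) \<le> t * u x"
          using t by (simp add: field_simps)
      qed
      moreover have "u \<le> p"
        using False C(1) lower by (metis (no_types, lifting) all_not_in_conv le_fun_def order_trans)
      ultimately show ?thesis
        using lower by (auto simp: le_fun_def)
    qed
  qed
  then show thesis
    using that by (metis (mono_tags, lifting) mem_Collect_eq order_trans)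
qed

text \<open>By minimality \<open>q\<close> coincides with each of its shifts. Taking the parameter
  \<open>t = 1\<close> in the shift gives \<open>q x + q a \<le> q (x + a)\<close>, the converse of
  subadditivity; additivity then gives oddness and so homogeneity for negative scalars.\<close>

lemma minimal_sublinear_imp_linear:
  fixes q :: "'v::real_vector \<Rightarrow> real"
  assumes q: "sublinear q" and min: "\<And>r. sublinear r \<Longrightarrow> r \<le> q \<Longrightarrow> r = q"
  shows "linear q"
proof -
  have "sublinear_shift q a = q" for a
    using sublinear_shift_le[OF q, of 0 a]
    by (intro min sublinear_sublinear_shift[OF q]) (simp add: le_fun_def)
  then have "q x \<le> q (x + a) - q a" for x a
    using sublinear_shift_le[OF q, of 1 a x] by simp
  then have add: "q (x + y) = q x + q y" for x y
    using sublinear_add[OF q, of x y] by (smt (verit))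
  have neg: "q (- x) = - q x" for x
    using add[of x "- x"] sublinear_0[OF q] by simp
  have "q (t *\<^sub>R x) = t *\<^sub>R q x" for t x
  proof (cases t "0 :: real" rule: linorder_cases)
    case less
    then show ?thesis
      using sublinear_scaleR[OF q, of "- t" x] neg[of "t *\<^sub>R x"] by simp
  qed (simp_all add: sublinear_0[OF q] sublinear_scaleR[OF q])
  with add show ?thesis by (intro linearI)
qed

text \<open>Minimality is sought below the shift of \<open>p\<close> rather than below
  \<open>p\<close>: the shift is at most \<open>- p a\<close> at \<open>- a\<close>, and this forces
  \<open>f a\<close> up to \<open>p a\<close>.\<close>

theorem hahn_banach_sublinear:
  fixes p :: "'v::real_vector \<Rightarrow> real"
  assumes p: "sublinear p"
  obtains f where "linear f" "\<And>x. f x \<le> p x" "f a = p a"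
proof -
  obtain f where f: "sublinear f" "f \<le> sublinear_shift p a"
      "\<And>r. sublinear r \<Longrightarrow> r \<le> f \<Longrightarrow> r = f"
    using minimal_sublinear_below[OF sublinear_sublinear_shift[OF p]] by metis
  then have lin: "linear f"
    by (intro minimal_sublinear_imp_linear)
  have le: "f x \<le> p x" for x
    using sublinear_shift_le[OF p, of 0 a x] f(2) by (auto simp: le_fun_def intro: order_trans)
  have "f (- a) \<le> p (- a + 1 *\<^sub>R a) - 1 * p a"
    using sublinear_shift_le[OF p, of 1 a "- a"] f(2) by (auto simp: le_fun_def intro: order_trans)
  then have "p a \<le> f a"
    using linear_neg[OF lin, of a] sublinear_0[OF p] by simp
  with lin le show thesis
    using that by (metis antisym)
qed

section \<open>Order and norm in a Banach lattice\<close>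

lemma sup_minus_nonneg: "0 \<le> sup x (- x :: 'e::banach_lattice)"
proof -
  have "x + - x \<le> sup x (- x) + sup x (- x)"
    by (intro add_mono) auto
  then have "0 \<le> (1/2) *\<^sub>R (2 *\<^sub>R sup x (- x))"
    unfolding scaleR_2 by (intro scaleR_nonneg_nonneg) auto
  then show ?thesis by simp
qed

lemma norm_mono_nonneg:
  fixes x y :: "'e::banach_lattice"
  assumes "0 \<le> x" "x \<le> y"
  shows "norm x \<le> norm y"
proof (rule lattice_norm_mono)
  have "sup x (- x) = x" "sup y (- y) = y"
    using assms by (auto intro!: sup_absorb1 intro: order_trans[of _ 0])
  then show "sup x (- x) \<le> sup y (- y)"
    using assms by simp
qed

lemma norm_sup_0_le: "norm (sup x 0) \<le> norm (x :: 'e::banach_lattice)"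
proof (rule lattice_norm_mono)
  have "sup (sup x 0) (- sup x 0) = sup x 0"
    by (rule sup_absorb1) (rule order_trans[of _ 0], simp_all)
  then show "sup (sup x 0) (- sup x 0) \<le> sup x (- x)"
    using sup_minus_nonneg[of x] by simp
qed

lemma norm_sup_0_mono:
  fixes x y :: "'e::banach_lattice"
  assumes "x \<le> y"
  shows "norm (sup x 0) \<le> norm (sup y 0)"
  using assms by (intro norm_mono_nonneg sup_mono sup_ge2 order_refl)

text \<open>Positivity becomes the vanishing of the norm of the negative part, a form that passes to
  norm limits and fits the sublinear functional used for separation.\<close>

lemma nonneg_iff_norm_sup_0: "0 \<le> x \<longleftrightarrow> norm (sup (- x) 0) = 0"
  for x :: "'e::banach_lattice"
proof -
  have "norm (sup (- x) 0) = 0 \<longleftrightarrow> sup (- x) 0 = 0" by simp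
  also have "\<dots> \<longleftrightarrow> - x \<le> 0" by (rule le_iff_sup[symmetric])
  finally show ?thesis by simp
qed

text \<open>Since \<open>- x \<le> X n - x\<close>, the negative part of the limit is dominated in
  norm by \<open>X n - x\<close>, which tends to zero.\<close>

lemma tendsto_nonneg:
  fixes X :: "nat \<Rightarrow> 'e::banach_lattice"
  assumes "X \<longlonglongrightarrow> x" "\<And>n. 0 \<le> X n"
  shows "0 \<le> x"
proof -
  have "norm (sup (- x) 0) \<le> norm (X n - x)" for n
    using norm_sup_0_mono[of "- x" "X n - x"] norm_sup_0_le[of "X n - x"] assms(2)[of n]
    by (simp add: algebra_simps)
  moreover have "(\<lambda>n. norm (X n - x)) \<longlonglongrightarrow> 0"
    using assms(1) by (simp add: LIM_zero tendsto_norm_zero)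
  ultimately have "norm (sup (- x) 0) \<le> 0"
    by (intro LIMSEQ_le_const) blast+
  then show ?thesis by (simp only: nonneg_iff_norm_sup_0 norm_le_zero_iff norm_eq_zero)
qed

lemma tendsto_le_banach_lattice:
  fixes X Y :: "nat \<Rightarrow> 'e::banach_lattice"
  assumes "X \<longlonglongrightarrow> x" "Y \<longlonglongrightarrow> y" "\<And>n. X n \<le> Y n"
  shows "x \<le> y"
  using tendsto_nonneg[OF tendsto_diff[OF assms(2,1)]] assms(3) by (simp only: diff_ge_0_iff_ge)

lemma diff_nonneg_decomposition:
  fixes x :: "'e::banach_lattice"
  obtains y z where "0 \<le> y" "0 \<le> z" "x = y - z"
  using that[of "sup x 0" "sup x 0 - x"] by simp

text \<open>Hahn--Banach is applied to the sublinear functional \<open>\<lambda>z. norm (sup z 0)\<close>: a linear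
  functional below it is contractive, and it is positive because \<open>sup z 0\<close> vanishes for \<open>z \<le> 0\<close>.\<close>

lemma nonneg_if_positive_functionals_nonneg:
  fixes y :: "'e::banach_lattice"
  assumes "\<And>f :: 'e \<Rightarrow>\<^sub>L real. (\<And>x. 0 \<le> x \<Longrightarrow> 0 \<le> f x) \<Longrightarrow> 0 \<le> f y"
  shows "0 \<le> y"
proof -
  let ?p = "\<lambda>z :: 'e. norm (sup z 0)"
  have "sublinear ?p"
    unfolding sublinear_def
  proof (intro conjI allI impI)
    fix x z :: 'e
    have "?p (x + z) \<le> norm (sup x 0 + sup z 0)"
      by (intro norm_mono_nonneg le_supI add_mono add_nonneg_nonneg) simp_all
    also have "\<dots> \<le> ?p x + ?p z"
      by (rule norm_triangle_ineq)
    finally show "?p (x + z) \<le> ?p x + ?p z" .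
  next
    fix t :: real and x :: 'e assume t: "0 < t"
    have "?p (t *\<^sub>R x) \<le> norm (t *\<^sub>R sup x 0)"
      using t by (intro norm_mono_nonneg le_supI scaleR_left_mono scaleR_nonneg_nonneg) simp_all
    then show "?p (t *\<^sub>R x) \<le> t * ?p x"
      using t by simp
  qed
  \<comment> \<open>The functional is made exact at \<open>- y\<close>, where its value is the norm
    of the negative part of \<open>y\<close>; then \<open>0 \<le> f y\<close> leaves only the value
    zero.\<close>
  then obtain f where f: "linear f" "\<And>x. f x \<le> ?p x" "f (- y) = ?p (- y)"
    using hahn_banach_sublinear by blast
  have "\<bar>f x\<bar> \<le> norm x * 1" for x
    using f(2)[of x] f(2)[of "- x"] norm_sup_0_le[of x] norm_sup_0_le[of "- x"] linear_neg[OF f(1), of x]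
    by simp
  then have "bounded_linear f"
    using f(1) by (intro bounded_linear_intro[where K = 1]) (auto simp: linear_add linear_scale)
  then have F: "blinfun_apply (Blinfun f) = f"
    by (rule bounded_linear_Blinfun_apply)
  have "0 \<le> f x" if "0 \<le> x" for x
    using f(2)[of "- x"] linear_neg[OF f(1), of x] that nonneg_iff_norm_sup_0[of x] by simp
  then have "0 \<le> f y"
    using assms[of "Blinfun f"] F by simp
  then have "?p (- y) = 0"
    using f(3) linear_neg[OF f(1), of y] norm_ge_zero[of "sup (- y) 0"] by linarith
  then show ?thesis
    by (simp only: nonneg_iff_norm_sup_0)
qed

section \<open>Function spaces on locally compact Hausdorff spaces\<close>

lemma bounded_borelI:
  assumes "\<phi> \<in> borel_measurable borel" "\<And>x. \<bar>\<phi> x\<bar> \<le> M"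
  shows "\<phi> \<in> bounded_borel"
  using assms by (auto simp: bounded_borel_def intro!: boundedI)

lemma bounded_borelE:
  assumes "\<phi> \<in> bounded_borel"
  obtains M where "0 < M" "\<And>x. \<bar>\<phi> x\<bar> \<le> M"
  using assms by (auto simp: bounded_borel_def bounded_pos)

lemma bounded_borel_add:
  assumes "\<phi> \<in> bounded_borel" "\<psi> \<in> bounded_borel"
  shows "(\<lambda>x. \<phi> x + \<psi> x) \<in> bounded_borel"
proof -
  obtain M N where "\<And>x. \<bar>\<phi> x\<bar> \<le> M" "\<And>x. \<bar>\<psi> x\<bar> \<le> N"
    using assms by (meson bounded_borelE)
  then have "\<bar>\<phi> x + \<psi> x\<bar> \<le> M + N" for x
    by (meson abs_triangle_ineq add_mono order_trans)
  then show ?thesis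
    using assms by (intro bounded_borelI[where M = "M + N"]) (auto simp: bounded_borel_def)
qed

lemma bounded_borel_scale:
  assumes "\<phi> \<in> bounded_borel"
  shows "(\<lambda>x. c * \<phi> x) \<in> bounded_borel"
proof -
  obtain M where "\<And>x. \<bar>\<phi> x\<bar> \<le> M"
    using assms by (meson bounded_borelE)
  then show ?thesis
    using assms by (intro bounded_borelI[where M = "\<bar>c\<bar> * M"])
      (auto simp: bounded_borel_def abs_mult mult_left_mono)
qed

lemma bounded_borel_diff:
  "\<phi> \<in> bounded_borel \<Longrightarrow> \<psi> \<in> bounded_borel \<Longrightarrow> (\<lambda>x. \<phi> x - \<psi> x) \<in> bounded_borel"
  using bounded_borel_add[of \<phi> "\<lambda>x. - 1 * \<psi> x"] bounded_borel_scale[of \<psi> "- 1"] by simp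

lemma bounded_borel_indicator: "A \<in> sets borel \<Longrightarrow> indicat_real A \<in> bounded_borel"
  by (rule bounded_borelI[where M = 1]) (auto simp: indicator_def)

lemma bounded_borel_sum:
  "(\<And>i. i \<in> I \<Longrightarrow> \<phi> i \<in> bounded_borel) \<Longrightarrow> (\<lambda>x. \<Sum>i\<in>I. \<phi> i x) \<in> bounded_borel"
proof (induction I rule: infinite_finite_induct)
  case (insert i I)
  then show ?case by (simp add: bounded_borel_add)
qed (auto intro: bounded_borelI[where M = 0])

lemma abs_le_sup_norm: "\<phi> \<in> bounded_borel \<Longrightarrow> \<bar>\<phi> x\<bar> \<le> sup_norm \<phi>"
  unfolding sup_norm_def
  by (rule cSUP_upper) (auto elim!: bounded_borelE intro: bdd_aboveI2)

lemma sup_norm_le: "(\<And>x. \<bar>\<phi> x\<bar> \<le> M) \<Longrightarrow> sup_norm \<phi> \<le> M"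
  unfolding sup_norm_def by (rule cSUP_least) auto

lemma C0_subset_bounded_borel: "C0 \<subseteq> bounded_borel"
proof
  fix \<phi> :: "'a \<Rightarrow> real" assume "\<phi> \<in> C0"
  then have cont: "continuous_on UNIV \<phi>" and cpt: "compact {x. 1 \<le> \<bar>\<phi> x\<bar>}"
    by (auto simp: C0_def)
  have "bounded (\<phi> ` {x. 1 \<le> \<bar>\<phi> x\<bar>})"
    using cont cpt by (intro compact_imp_bounded compact_continuous_image)
      (auto intro: continuous_on_subset)
  then obtain M where M: "\<And>x. 1 \<le> \<bar>\<phi> x\<bar> \<Longrightarrow> \<bar>\<phi> x\<bar> \<le> M"
    by (auto simp: bounded_iff)
  have "\<bar>\<phi> x\<bar> \<le> max M 1" for x
    using M[of x] by (cases "1 \<le> \<bar>\<phi> x\<bar>") auto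
  then show "\<phi> \<in> bounded_borel"
    using cont by (intro bounded_borelI[where M = "max M 1"] borel_measurable_continuous_onI)
qed

lemma Cc_subset_C0: "Cc \<subseteq> C0"
proof
  fix \<phi> :: "'a \<Rightarrow> real" assume "\<phi> \<in> Cc"
  then have cont: "continuous_on UNIV \<phi>" and cpt: "compact (tsupp \<phi>)"
    by (auto simp: Cc_def)
  have "compact {x. e \<le> \<bar>\<phi> x\<bar>}" if "0 < e" for e
  proof -
    have "closed {x. e \<le> \<bar>\<phi> x\<bar>}"
      using cont by (intro closed_Collect_le continuous_intros)
    moreover have "{x. e \<le> \<bar>\<phi> x\<bar>} \<subseteq> {x. \<phi> x \<noteq> 0}"
      using that by auto
    then have "{x. e \<le> \<bar>\<phi> x\<bar>} \<subseteq> tsupp \<phi>"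
      unfolding tsupp_def using closure_subset by fast
    ultimately show ?thesis
      using compact_Int_closed[OF cpt] by (metis inf.absorb2)
  qed
  with cont show "\<phi> \<in> C0"
    by (simp add: C0_def)
qed

lemma indicator_le_iff:
  assumes "\<And>x. 0 \<le> \<phi> x"
  shows "indicat_real K \<le> \<phi> \<longleftrightarrow> (\<forall>x\<in>K. 1 \<le> \<phi> x)"
  using assms by (auto simp: le_fun_def indicator_def)

lemma le_indicator_of_tsupp:
  assumes "tsupp \<phi> \<subseteq> V" "\<And>x. \<phi> x \<le> 1"
  shows "\<phi> \<le> indicat_real V"
proof (rule le_funI)
  fix x
  have "\<phi> x \<noteq> 0 \<Longrightarrow> x \<in> V"
    using assms(1) closure_subset[of "{x. \<phi> x \<noteq> 0}"] by (auto simp: tsupp_def)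
  then show "\<phi> x \<le> indicat_real V x"
    using assms(2)[of x] by (cases "\<phi> x = 0") auto
qed

text \<open>The cutoff \<open>max 0 (2 f - 1)\<close> of a Urysohn function \<open>f\<close> has its support in the closed
  set \<open>{x. 1 / 2 \<le> f x}\<close>, on which \<open>f\<close> does not vanish.\<close>

lemma Urysohn_Cc:
  fixes K V :: "'a::t2_space set"
  assumes lc: "locally_compact_space (euclidean :: 'a topology)"
    and K: "compact K" and V: "open V" "K \<subseteq> V"
  obtains \<phi> where "\<phi> \<in> Cc" "tsupp \<phi> \<subseteq> V" "\<And>x. 0 \<le> \<phi> x" "\<And>x. \<phi> x \<le> 1"
    "\<And>x. x \<in> K \<Longrightarrow> \<phi> x = 1"
proof -
  have T2: "Hausdorff_space (euclidean :: 'a topology)"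
    by (auto simp: Hausdorff_space_def disjnt_def) (metis hausdorff)
  then have creg: "completely_regular_space (euclidean :: 'a topology)"
    using lc locally_compact_Hausdorff_imp_regular_space completely_regular_eq_regular_space by blast
  \<comment> \<open>Local compactness provides the compact set \<open>L\<close>. Making the Urysohn
    function vanish outside \<open>U \<inter> V\<close> later traps the support in \<open>L\<close>
    and in \<open>V\<close> at once.\<close>
  obtain U L where UL: "open U" "compact L" "K \<subseteq> U" "U \<subseteq> L"
    using lc K locally_compact_space_compact_closed_compact[of "euclidean :: 'a topology"] T2
    by (auto simp: compactin_euclidean_iff)
  obtain f where f: "continuous_map (euclidean :: 'a topology) (top_of_set {0..1::real}) f"
      "f ` (- (U \<inter> V)) \<subseteq> {0}" "f ` K \<subseteq> {1}"
    using Urysohn_completely_regular_compact_closed[of 0 1 euclidean K "- (U \<inter> V)"] creg K V UL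
    by (auto simp: disjnt_iff open_Int closed_Compl)
  define \<phi> where "\<phi> x = max 0 (2 * f x - 1)" for x
  have contf: "continuous_on UNIV f" and f01: "0 \<le> f x" "f x \<le> 1" for x
    using f(1) by (auto simp: continuous_map_in_subtopology Pi_iff)
  have cl: "closed {x. 1 / 2 \<le> f x}"
    using contf by (intro closed_Collect_le continuous_intros)
  have "{x. \<phi> x \<noteq> 0} \<subseteq> {x. 1 / 2 \<le> f x}"
    by (auto simp: \<phi>_def)
  then have "tsupp \<phi> \<subseteq> {x. 1 / 2 \<le> f x}"
    unfolding tsupp_def using cl by (rule closure_minimal)
  also have "\<dots> \<subseteq> U \<inter> V"
    using f(2) by (fastforce simp: image_subset_iff)
  finally have supp: "tsupp \<phi> \<subseteq> U \<inter> V" .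
  have "closed (tsupp \<phi>)"
    by (simp add: tsupp_def)
  then have "compact (tsupp \<phi>)"
    using compact_Int_closed[OF UL(2)] supp UL(4) by (metis inf.absorb2 le_infE order_trans)
  moreover have "continuous_on UNIV \<phi>"
    unfolding \<phi>_def using contf by (intro continuous_intros)
  ultimately show thesis
    using supp f(3) f01 by (intro that[of \<phi>]) (auto simp: \<phi>_def Cc_def)
qed

section \<open>Suprema of sequences of bounded Borel functions\<close>

text \<open>Otherwise \<open>g\<close> could be lowered to \<open>c\<close> at the single point
  \<open>x\<close> and remain an upper bound. The modified function is Borel because points are
  closed in a Hausdorff space.\<close>

lemma is_sup_in_bounded_borel_pointwise:
  fixes g :: "'a::t2_space \<Rightarrow> real"
  assumes sup: "is_sup_in (\<le>) bounded_borel S g" and c: "c < g x"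
  shows "\<exists>\<phi>\<in>S. c < \<phi> x"
proof (rule ccontr)
  assume "\<not> ?thesis"
  then have le: "\<phi> x \<le> c" if "\<phi> \<in> S" for \<phi>
    using that by force
  let ?u = "\<lambda>y. g y + (c - g x) * indicat_real {x} y"
  have "?u \<in> bounded_borel"
    using sup by (intro bounded_borel_add bounded_borel_scale bounded_borel_indicator)
      (auto simp: is_sup_in_def)
  moreover have "\<phi> \<le> ?u" if "\<phi> \<in> S" for \<phi>
    using sup le[OF that] that by (auto simp: is_sup_in_def le_fun_def indicator_def)
  ultimately have "g \<le> ?u"
    using sup unfolding is_sup_in_def by blast
  then show False
    using c by (auto dest!: le_funD[of _ _ x])
qed

lemma increases_to_in_bounded_borelD:
  fixes g :: "'a::t2_space \<Rightarrow> real"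
  assumes inc: "increases_to_in (\<le>) bounded_borel \<phi> g"
  shows "incseq \<phi>" and "(\<lambda>n. \<phi> n x) \<longlonglongrightarrow> g x"
proof -
  show mono: "incseq \<phi>"
    using inc by (intro incseq_SucI) (simp add: increases_to_in_def)
  have sup: "is_sup_in (\<le>) bounded_borel (range \<phi>) g"
    using inc by (simp add: increases_to_in_def)
  then have le: "\<phi> n x \<le> g x" for n
    by (auto simp: is_sup_in_def le_fun_def)
  show "(\<lambda>n. \<phi> n x) \<longlonglongrightarrow> g x"
  proof (rule order_tendstoI)
    fix c assume "c < g x"
    then obtain N where N: "c < \<phi> N x"
      using is_sup_in_bounded_borel_pointwise[OF sup] by blast
    have "\<phi> N x \<le> \<phi> n x" if "N \<le> n" for n
      using incseqD[OF mono that] by (simp add: le_fun_def)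
    with N show "eventually (\<lambda>n. c < \<phi> n x) sequentially"
      by (auto simp: eventually_sequentially intro: less_le_trans)
  next
    fix c assume "g x < c"
    with le have "\<phi> n x < c" for n
      by (rule le_less_trans)
    then show "eventually (\<lambda>n. \<phi> n x < c) sequentially"
      by simp
  qed
qed

lemma sigma_compact_if_is_sup_in:
  fixes \<phi> :: "nat \<Rightarrow> 'a::t2_space \<Rightarrow> real"
  assumes \<phi>: "\<And>n. \<phi> n \<in> C0"
    and sup: "is_sup_in (\<le>) bounded_borel (range \<phi>) (indicat_real V)"
  shows "sigma_compact V"
  unfolding sigma_compact_def
proof (intro exI conjI allI)
  \<comment> \<open>Any level strictly between 0 and 1 would do: positivity gives compactness and
    keeps the set inside \<open>V\<close>, and being below 1 lets the supremum exceed it at each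
    point of \<open>V\<close>.\<close>
  let ?K = "\<lambda>n. {x. 1 / 2 \<le> \<phi> n x}"
  show "compact (?K n)" for n
  proof -
    have "compact {x. e \<le> \<bar>\<phi> n x\<bar>}" if "0 < e" for e
      using \<phi>[of n] that by (simp add: C0_def)
    from this[of "1 / 2"] have "compact {x. 1 / 2 \<le> \<bar>\<phi> n x\<bar>}"
      by simp
    \<comment> \<open>The functions may take negative values, so the superlevel set is cut out of
      the compact set for the absolute value as a closed part.\<close>
    moreover have "closed (?K n)"
      using \<phi>[of n] by (intro closed_Collect_le continuous_intros) (simp add: C0_def)
    moreover have "{x. 1 / 2 \<le> \<bar>\<phi> n x\<bar>} \<inter> ?K n = ?K n"
      by auto
    ultimately show ?thesis
      using compact_Int_closed by metis
  qed
  have le: "\<phi> n x \<le> indicat_real V x" for n x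
    using sup by (auto simp: is_sup_in_def le_fun_def)
  show "V = (\<Union>n. ?K n)"
  proof (intro equalityI subsetI)
    fix x assume "x \<in> V"
    then obtain n where "1 / 2 < \<phi> n x"
      using is_sup_in_bounded_borel_pointwise[OF sup, of "1 / 2" x] by auto
    then show "x \<in> (\<Union>n. ?K n)" by (auto intro: less_imp_le)
  next
    fix x assume "x \<in> (\<Union>n. ?K n)"
    then obtain n where "1 / 2 \<le> \<phi> n x" by auto
    then have "indicat_real V x \<noteq> 0"
      using le[of n x] by linarith
    then show "x \<in> V" by (simp add: indicator_eq_0_iff)
  qed
qed

text \<open>Each function of the sequence is \<open>1\<close> on the support of its predecessor, which makes the
  sequence increasing.\<close>

lemma sigma_compact_imp_increasing_Cc:
  fixes V :: "'a::t2_space set"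
  assumes lc: "locally_compact_space (euclidean :: 'a topology)"
    and V: "open V" "sigma_compact V"
  obtains \<phi> :: "nat \<Rightarrow> 'a \<Rightarrow> real" where
    "\<And>n. \<phi> n \<in> Cc" "\<And>n. tsupp (\<phi> n) \<subseteq> V" "\<And>n x. 0 \<le> \<phi> n x" "\<And>n x. \<phi> n x \<le> 1"
    "increases_to_in (\<le>) bounded_borel \<phi> (indicat_real V)"
proof -
  obtain K :: "nat \<Rightarrow> 'a set" where K: "\<And>n. compact (K n)" "V = (\<Union>n. K n)"
    using V(2) by (auto simp: sigma_compact_def)
  let ?P = "\<lambda>n \<phi>. \<phi> \<in> Cc \<and> tsupp \<phi> \<subseteq> V \<and> (\<forall>x. 0 \<le> \<phi> x \<and> \<phi> x \<le> 1) \<and> (\<forall>x\<in>K n. \<phi> x = 1)"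
  have "\<exists>\<phi>. \<forall>n. ?P n (\<phi> n) \<and> \<phi> n \<le> \<phi> (Suc n)"
  proof (rule dependent_nat_choice)
    show "\<exists>\<phi>. ?P 0 \<phi>"
      using Urysohn_Cc[OF lc K(1) V(1), of 0] K(2) by (metis UN_upper UNIV_I)
  next
    fix \<phi> n assume \<phi>: "?P n \<phi>"
    then have "compact (K (Suc n) \<union> tsupp \<phi>)" "K (Suc n) \<union> tsupp \<phi> \<subseteq> V"
      using K by (auto simp: Cc_def)
    then obtain \<psi> where \<psi>: "\<psi> \<in> Cc" "tsupp \<psi> \<subseteq> V" "\<And>x. 0 \<le> \<psi> x" "\<And>x. \<psi> x \<le> 1"
        "\<And>x. x \<in> K (Suc n) \<union> tsupp \<phi> \<Longrightarrow> \<psi> x = 1"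
      using Urysohn_Cc[OF lc _ V(1)] by metis
    have "\<phi> \<le> indicat_real (tsupp \<phi>)"
      using \<phi> by (intro le_indicator_of_tsupp) auto
    also have "\<dots> \<le> \<psi>"
      using \<psi>(3,5) by (simp add: indicator_le_iff)
    finally show "\<exists>\<psi>. ?P (Suc n) \<psi> \<and> \<phi> \<le> \<psi>"
      using \<psi> by blast
  qed
  then obtain \<phi> where \<phi>: "\<And>n. ?P n (\<phi> n)" "\<And>n. \<phi> n \<le> \<phi> (Suc n)"
    by metis
  have "is_sup_in (\<le>) bounded_borel (range \<phi>) (indicat_real V)"
    unfolding is_sup_in_def
  proof (intro conjI ballI impI)
    show "indicat_real V \<in> bounded_borel"
      using V(1) by (intro bounded_borel_indicator) auto
    show "\<psi> \<le> indicat_real V" if "\<psi> \<in> range \<phi>" for \<psi>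
      using that \<phi>(1) by (auto intro!: le_indicator_of_tsupp)
    show "indicat_real V \<le> u" if "\<forall>\<psi>\<in>range \<phi>. \<psi> \<le> u" for u
    proof -
      have le: "\<phi> n x \<le> u x" for n x
        using that by (auto simp: le_fun_def)
      have "0 \<le> u x" for x
        using le[of 0 x] \<phi>(1)[of 0] by (auto intro: order_trans)
      moreover have "1 \<le> u x" if x: "x \<in> V" for x
      proof -
        obtain n where "x \<in> K n" using x K(2) by auto
        then show ?thesis using le[of n x] \<phi>(1)[of n] by auto
      qed
      ultimately show ?thesis
        by (simp add: indicator_le_iff)
    qed
  qed
  then show thesis
    using \<phi> by (intro that[of \<phi>]) (auto simp: increases_to_in_def)
qed

section \<open>Operator order and weak operator topology\<close>

lemma positive_operator_blinfun:
  "positive_operator (blinfun_apply T) \<longleftrightarrow> (\<forall>x\<ge>0. 0 \<le> T x)"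
  for T :: "'e::banach_lattice \<Rightarrow>\<^sub>L 'f::banach_lattice"
  by (simp add: positive_operator_def blinfun.bounded_linear_right bounded_linear.linear)

lemma operator_le_iff: "operator_le S T \<longleftrightarrow> (\<forall>x\<ge>0. S x \<le> T x)"
  by (simp add: operator_le_def positive_operator_blinfun blinfun.diff_left)

lemma positive_operator_regular:
  assumes "positive_operator (blinfun_apply T)"
  shows "T \<in> regular_operators"
  unfolding regular_operators_def
  using assms by (intro CollectI exI[of _ "blinfun_apply T"] exI[of _ "\<lambda>_. 0"])
    (simp add: positive_operator_def linear_iff)

text \<open>The error \<open>e\<close> is fixed together with \<open>z\<close> and the positive
  functional \<open>f\<close>, so the approximating set used to verify the premise may depend on all
  three.\<close>

lemma operator_leI_functionals:
  fixes S T :: "'e::banach_lattice \<Rightarrow>\<^sub>L 'e"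
  assumes "\<And>z (f :: 'e \<Rightarrow>\<^sub>L real) e. \<lbrakk>0 \<le> z; \<And>x. 0 \<le> x \<Longrightarrow> 0 \<le> blinfun_apply f x; 0 < e\<rbrakk>
    \<Longrightarrow> blinfun_apply f (S z) < blinfun_apply f (T z) + e"
  shows "operator_le S T"
  unfolding operator_le_iff
proof (intro allI impI)
  fix z :: 'e assume z: "0 \<le> z"
  have "0 \<le> T z - S z"
  proof (rule nonneg_if_positive_functionals_nonneg)
    fix f :: "'e \<Rightarrow>\<^sub>L real" assume f: "\<And>x. 0 \<le> x \<Longrightarrow> 0 \<le> blinfun_apply f x"
    have "f (S z) \<le> f (T z)"
    proof (rule field_le_epsilon)
      fix e :: real assume "0 < e"
      with z f show "f (S z) \<le> f (T z) + e"
        by (rule less_imp_le[OF assms])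
    qed
    then show "0 \<le> f (T z - S z)"
      by (simp add: blinfun.diff_right)
  qed
  then show "S z \<le> T z" by simp
qed

lemma blinfun_monoD:
  fixes f :: "'e::banach_lattice \<Rightarrow>\<^sub>L real"
  assumes "\<And>x. 0 \<le> x \<Longrightarrow> 0 \<le> blinfun_apply f x" "x \<le> y"
  shows "blinfun_apply f x \<le> blinfun_apply f y"
  using assms(1)[of "y - x"] assms(2) by (simp add: blinfun.diff_right)

text \<open>The Euclidean topology on a function space is the product topology, so convergence in
  the pullback is convergence at each pair of a vector and a functional; continuity of the
  functional makes strong convergence sufficient.\<close>

lemma limitin_weak_operator_topologyI:
  assumes "\<And>x. (\<lambda>n. blinfun_apply (T n) x) \<longlonglongrightarrow> blinfun_apply S x"
  shows "limitin weak_operator_topology T S sequentially"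
proof -
  let ?F = "\<lambda>T (x, x'). blinfun_apply (x' :: 'b \<Rightarrow>\<^sub>L real) (blinfun_apply T x)"
  have "limitin (product_topology (\<lambda>_. euclidean) UNIV) (\<lambda>n. ?F (T n)) (?F S) sequentially"
    using blinfun.tendsto[OF tendsto_const assms] by (auto simp: limitin_componentwise)
  then have lim: "limitin euclidean (\<lambda>n. ?F (T n)) (?F S) sequentially"
    by (simp add: euclidean_product_topology)
  show ?thesis
    unfolding limitin_def weak_operator_topology_def
    using lim by (auto simp: limitin_def openin_pullback_topology topspace_pullback_topology)
qed

section \<open>Regular measures\<close>

text \<open>Only \<open>M\<close> has to be approximated. Passing from \<open>V\<close> to
  \<open>K\<close> decreases \<open>N\<close>, which enters with a minus sign, so the one-sided
  estimate survives.\<close>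

lemma regular_finite_signed_inner:
  fixes \<mu> :: "'a::t2_space set \<Rightarrow> real"
  assumes \<mu>: "regular_finite_signed_borel_measure \<mu>" and V: "open V" and e: "0 < e"
  obtains K where "compact K" "K \<subseteq> V" "\<mu> V < \<mu> K + e"
proof -
  obtain M N where M: "regular_finite_borel_measure M" and N: "regular_finite_borel_measure N"
    and MN: "\<And>D. D \<in> sets borel \<Longrightarrow> \<mu> D = measure M D - measure N D"
    using \<mu> by (auto simp: regular_finite_signed_borel_measure_def)
  interpret M: finite_measure M using M by (simp add: regular_finite_borel_measure_def)
  interpret N: finite_measure N using N by (simp add: regular_finite_borel_measure_def)
  have sets: "sets N = sets borel"
    using N by (simp add: regular_finite_borel_measure_def)
  have SUP: "emeasure M V = (SUP K\<in>{K. compact K \<and> K \<subseteq> V}. emeasure M K)"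
    using M V unfolding regular_finite_borel_measure_def by blast
  have "\<exists>K\<in>{K. compact K \<and> K \<subseteq> V}. emeasure M V < emeasure M K + ennreal e"
    by (rule SUP_approx_ennreal[OF e _ SUP]) (auto intro: exI[of _ "{}"])
  then obtain K where K: "compact K" "K \<subseteq> V" "emeasure M V < emeasure M K + ennreal e"
    by blast
  have "measure M V < measure M K + e"
    using K(3) e by (simp add: M.emeasure_eq_measure ennreal_less_iff flip: ennreal_plus)
  moreover have "measure N K \<le> measure N V"
    using K V by (intro N.finite_measure_mono) (auto simp: sets)
  ultimately show thesis
    using K V MN[of V] MN[of K] by (intro that[of K]) (auto simp: borel_compact)
qed

text \<open>Again only \<open>M\<close> is approximated: enlarging \<open>B\<close> to
  \<open>U\<close> increases \<open>N\<close>, which can only lower the difference.\<close>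

lemma regular_finite_signed_outer:
  fixes \<mu> :: "'a::topological_space set \<Rightarrow> real"
  assumes \<mu>: "regular_finite_signed_borel_measure \<mu>" and B: "B \<in> sets borel" and e: "0 < e"
  obtains U where "open U" "B \<subseteq> U" "\<mu> U < \<mu> B + e"
proof -
  obtain M N where M: "regular_finite_borel_measure M" and N: "regular_finite_borel_measure N"
    and MN: "\<And>D. D \<in> sets borel \<Longrightarrow> \<mu> D = measure M D - measure N D"
    using \<mu> by (auto simp: regular_finite_signed_borel_measure_def)
  interpret M: finite_measure M using M by (simp add: regular_finite_borel_measure_def)
  interpret N: finite_measure N using N by (simp add: regular_finite_borel_measure_def)
  have sets: "sets N = sets borel"
    using N by (simp add: regular_finite_borel_measure_def)
  have INF: "emeasure M B = (INF U\<in>{U. open U \<and> B \<subseteq> U}. emeasure M U)"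
    using M B unfolding regular_finite_borel_measure_def by blast
  have "\<exists>U\<in>{U. open U \<and> B \<subseteq> U}. emeasure M U < emeasure M B + ennreal e"
    by (rule INF_approx_ennreal[OF e INF]) auto
  then obtain U where U: "open U" "B \<subseteq> U" "emeasure M U < emeasure M B + ennreal e"
    by blast
  have "measure M U < measure M B + e"
    using U(3) e by (simp add: M.emeasure_eq_measure ennreal_less_iff flip: ennreal_plus)
  moreover have "measure N B \<le> measure N U"
    using U B by (intro N.finite_measure_mono) (auto simp: sets)
  ultimately show thesis
    using U B MN[of U] MN[of B] by (intro that[of U]) auto
qed

section \<open>The representation generated by a positive spectral measure\<close>

locale generated_spectral_representation =
  fixes P :: "'a::t2_space set \<Rightarrow> 'e::banach_lattice \<Rightarrow>\<^sub>L 'e"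
    and \<rho> :: "('a \<Rightarrow> real) \<Rightarrow> 'e \<Rightarrow>\<^sub>L 'e"
  assumes spectral: "positive_spectral_measure P"
    and generated: "generated_representation P \<rho>"
begin

lemma rho_add:
  "\<phi> \<in> bounded_borel \<Longrightarrow> \<psi> \<in> bounded_borel \<Longrightarrow> \<rho> (\<lambda>x. \<phi> x + \<psi> x) = \<rho> \<phi> + \<rho> \<psi>"
  using generated by (simp add: generated_representation_def linear_map_on_def)

lemma rho_scale: "\<phi> \<in> bounded_borel \<Longrightarrow> \<rho> (\<lambda>x. c * \<phi> x) = c *\<^sub>R \<rho> \<phi>"
  using generated by (simp add: generated_representation_def linear_map_on_def)

lemma rho_indicator: "A \<in> sets borel \<Longrightarrow> \<rho> (indicat_real A) = P A"
  using generated by (simp add: generated_representation_def)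

lemma rho_diff:
  assumes "\<phi> \<in> bounded_borel" "\<psi> \<in> bounded_borel"
  shows "\<rho> (\<lambda>x. \<phi> x - \<psi> x) = \<rho> \<phi> - \<rho> \<psi>"
  using rho_add[OF assms(1) bounded_borel_scale[OF assms(2), of "- 1"]] rho_scale[OF assms(2), of "- 1"]
  by simp

lemma rho_sum:
  assumes "\<And>i. i \<in> I \<Longrightarrow> \<phi> i \<in> bounded_borel"
  shows "\<rho> (\<lambda>x. \<Sum>i\<in>I. \<phi> i x) = (\<Sum>i\<in>I. \<rho> (\<phi> i))"
  using assms
proof (induction I rule: infinite_finite_induct)
  case (insert i I)
  then show ?case by (simp add: rho_add bounded_borel_sum)
qed (use rho_scale[of "\<lambda>_. 0" 0] bounded_borelI[of "\<lambda>_. 0" 0] in auto)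

lemma rho_norm_le:
  obtains C where "0 \<le> C" "\<And>\<phi> M. \<phi> \<in> bounded_borel \<Longrightarrow> (\<And>x. \<bar>\<phi> x\<bar> \<le> M) \<Longrightarrow> norm (\<rho> \<phi>) \<le> C * M"
proof -
  obtain C where C: "\<And>\<phi>. \<phi> \<in> bounded_borel \<Longrightarrow> norm (\<rho> \<phi>) \<le> C * sup_norm \<phi>"
    using generated by (auto simp: generated_representation_def)
  \<comment> \<open>The definition states no sign for the constant; its absolute value keeps the
    estimate monotone in the bound \<open>M\<close>.\<close>
  have "norm (\<rho> \<phi>) \<le> \<bar>C\<bar> * M" if \<phi>: "\<phi> \<in> bounded_borel" and M: "\<And>x. \<bar>\<phi> x\<bar> \<le> M" for \<phi> M
  proof -
    have "0 \<le> sup_norm \<phi>"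
      using abs_le_sup_norm[OF \<phi>] abs_ge_zero order_trans by blast
    then have "C * sup_norm \<phi> \<le> \<bar>C\<bar> * sup_norm \<phi>"
      by (intro mult_right_mono) auto
    also have "\<dots> \<le> \<bar>C\<bar> * M"
      using sup_norm_le[of \<phi> M] M by (intro mult_left_mono) auto
    finally show ?thesis
      using C[OF \<phi>] by simp
  qed
  then show thesis
    using that[of "\<bar>C\<bar>"] by simp
qed

lemma P_nonneg: "A \<in> sets borel \<Longrightarrow> 0 \<le> z \<Longrightarrow> 0 \<le> P A z"
  using spectral by (simp add: positive_spectral_measure_def positive_operator_def)

text \<open>With \<open>N = Suc n\<close>, a function \<open>0 \<le> \<phi> \<le> M\<close> is within \<open>1 / N\<close> of the layer cake sum
  \<open>\<Sum>k=1..M * N. (1 / N) * indicator {\<phi> \<ge> k / N}\<close>, whose value at \<open>x\<close> is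
  \<open>\<lfloor>N * \<phi> x\<rfloor> / N\<close>.\<close>

lemma rho_nonneg:
  assumes \<phi>: "\<phi> \<in> bounded_borel" "\<And>x. 0 \<le> \<phi> x" and z: "0 \<le> z"
  shows "0 \<le> \<rho> \<phi> z"
proof -
  obtain M0 where M0: "\<And>x. \<bar>\<phi> x\<bar> \<le> M0"
    using \<phi>(1) by (meson bounded_borelE)
  obtain M :: nat where "M0 \<le> real M"
    using real_arch_simple by blast
  with M0 have M: "\<phi> x \<le> real M" for x
    by (meson abs_le_D1 order_trans)
  define D where "D n k = {x. real k / real (Suc n) \<le> \<phi> x}" for n k :: nat
  define s where "s n x = (\<Sum>k\<in>{1..M * Suc n}. (1 / real (Suc n)) * indicat_real (D n k) x)" for n x
  have D: "D n k \<in> sets borel" for n k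
  proof -
    have [measurable]: "\<phi> \<in> borel_measurable borel"
      using \<phi>(1) by (simp add: bounded_borel_def)
    show ?thesis
      unfolding D_def by measurable
  qed
  have s: "s n \<in> bounded_borel" for n
    unfolding s_def by (intro bounded_borel_sum bounded_borel_scale bounded_borel_indicator D)
  have approx: "\<bar>\<phi> x - s n x\<bar> \<le> 1 / real (Suc n)" for n x
  proof -
    let ?y = "real (Suc n) * \<phi> x"
    have y: "0 \<le> ?y" "?y \<le> real (M * Suc n)"
    proof -
      show "0 \<le> ?y"
        using \<phi>(2)[of x] by simp
      have "?y \<le> real (Suc n) * real M"
        by (intro mult_left_mono M) simp
      then show "?y \<le> real (M * Suc n)"
        by (simp only: of_nat_mult mult.commute)
    qed
    define c where "c = nat \<lfloor>?y\<rfloor>"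
    have mem: "x \<in> D n k \<longleftrightarrow> k \<le> c" for k
      using y(1)
      by (simp add: c_def D_def le_nat_iff le_floor_iff pos_divide_le_eq mult.commute del: of_nat_Suc)
    \<comment> \<open>Here \<open>c\<close> counts the positive levels reached at \<open>x\<close>.
      The bound on \<open>\<phi>\<close> keeps all of them in the summation range, so truncation
      loses nothing.\<close>
    have "c \<le> M * Suc n"
      using y unfolding c_def by linarith
    then have "{k \<in> {1..M * Suc n}. k \<le> c} = {1..c}"
      by (auto intro: order_trans simp del: mult_Suc_right)
    then have "(\<Sum>k\<in>{1..M * Suc n}. indicat_real (D n k) x) = real c"
      using sum.inter_filter[of "{1..M * Suc n}" "\<lambda>_. 1 :: real" "\<lambda>k. k \<le> c"]
      by (simp add: indicator_def mem of_bool_def del: mult_Suc_right)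
    then have "s n x = real c / real (Suc n)"
      unfolding s_def sum_distrib_left[symmetric] by simp
    then have "\<phi> x - s n x = (?y - real c) / real (Suc n)"
      by (simp add: diff_divide_distrib del: of_nat_Suc)
    moreover have "0 \<le> ?y - real c" "?y - real c \<le> 1"
      using y(1) unfolding c_def by linarith+
    ultimately show ?thesis
      by (simp add: divide_right_mono del: of_nat_Suc)
  qed
  obtain C where C: "0 \<le> C" "\<And>\<phi> M. \<phi> \<in> bounded_borel \<Longrightarrow> (\<And>x. \<bar>\<phi> x\<bar> \<le> M) \<Longrightarrow> norm (\<rho> \<phi>) \<le> C * M"
    using rho_norm_le by blast
  have bound: "norm (\<rho> (s n) - \<rho> \<phi>) \<le> C * (1 / real (Suc n))" for n
    using C(2)[OF bounded_borel_diff[OF \<phi>(1) s] approx] rho_diff[OF \<phi>(1) s]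
    by (simp add: norm_minus_commute)
  have "(\<lambda>n. C * (1 / real (Suc n))) \<longlonglongrightarrow> C * 0"
    by (intro tendsto_mult tendsto_const LIMSEQ_Suc lim_const_over_n)
  then have "(\<lambda>n. C * (1 / real (Suc n))) \<longlonglongrightarrow> 0"
    by (simp only: mult_zero_right)
  with bound have "(\<lambda>n. \<rho> (s n) - \<rho> \<phi>) \<longlonglongrightarrow> 0"
    by (rule Lim_null_comparison[OF always_eventually[OF allI]])
  then have "(\<lambda>n. \<rho> (s n) z) \<longlonglongrightarrow> \<rho> \<phi> z"
    by (intro blinfun.tendsto tendsto_const) (simp add: LIM_zero_iff)
  \<comment> \<open>Each step function is sent to a nonnegative combination of values of
    \<open>P\<close>, and the positive cone is norm closed.\<close>
  moreover have "0 \<le> \<rho> (s n) z" for n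
  proof -
    have "\<rho> (s n) = (\<Sum>k\<in>{1..M * Suc n}. (1 / real (Suc n)) *\<^sub>R P (D n k))"
      unfolding s_def
      by (simp only: rho_sum bounded_borel_scale bounded_borel_indicator rho_scale rho_indicator D)
    then show ?thesis
      using P_nonneg[OF D z]
      by (auto simp: blinfun.sum_left blinfun.scaleR_left intro!: sum_nonneg scaleR_nonneg_nonneg)
  qed
  ultimately show ?thesis
    by (rule tendsto_nonneg)
qed

lemma rho_mono:
  assumes "\<phi> \<in> bounded_borel" "\<psi> \<in> bounded_borel" "\<phi> \<le> \<psi>" "0 \<le> z"
  shows "\<rho> \<phi> z \<le> \<rho> \<psi> z"
  using rho_nonneg[OF bounded_borel_diff[OF assms(2,1)] _ assms(4)] assms(3)
  by (simp add: rho_diff assms(1,2) le_fun_def blinfun.diff_left)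

text \<open>The differences of consecutive sets partition \<open>A 0\<close>, and their partial sums
  telescope to \<open>P (A 0) z - P (A n) z\<close>; countable additivity makes these converge to
  \<open>P (A 0) z\<close>.\<close>

lemma P_decreasing_to_empty:
  assumes A: "\<And>n. A n \<in> sets borel" "decseq A" "(\<Inter>n. A n) = {}"
  shows "(\<lambda>n. P (A n) z) \<longlonglongrightarrow> 0"
proof -
  define D where "D n = A n - A (Suc n)" for n
  have sub: "A m \<subseteq> A n" if "n \<le> m" for m n
    using A(2) that by (auto simp: decseq_def)
  have D: "D n \<in> sets borel" for n
    using A(1) by (auto simp: D_def)
  \<comment> \<open>Subtractivity of \<open>P\<close> on nested sets is read off from linearity of
    \<open>\<rho>\<close> on indicators.\<close>
  have PD: "P (D n) = P (A n) - P (A (Suc n))" for n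
  proof -
    have "indicat_real (D n) = (\<lambda>x. indicat_real (A n) x - indicat_real (A (Suc n)) x)"
      using sub[of n "Suc n"] by (auto simp: D_def indicator_def fun_eq_iff)
    then show ?thesis
      using rho_diff[of "indicat_real (A n)" "indicat_real (A (Suc n))"] rho_indicator[OF D, of n]
      by (simp add: rho_indicator bounded_borel_indicator A(1))
  qed
  have disj: "disjoint_family D"
    unfolding disjoint_family_on_def
  proof (intro ballI impI)
    fix m n :: nat assume "m \<noteq> n"
    then consider "Suc m \<le> n" | "Suc n \<le> m" by linarith
    then show "D m \<inter> D n = {}"
      by cases (use sub in \<open>auto simp: D_def\<close>)
  qed
  have "(\<Union>n. D n) = A 0"
  proof (intro equalityI subsetI)
    fix x assume "x \<in> (\<Union>n. D n)"
    then show "x \<in> A 0" using sub by (auto simp: D_def)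
  next
    fix x assume "x \<in> A 0"
    moreover obtain n where "x \<notin> A n" using A(3) by auto
    ultimately obtain k where "x \<in> A k" "x \<notin> A (Suc k)"
      by (induction n) auto
    then show "x \<in> (\<Union>n. D n)" by (auto simp: D_def)
  qed
  then have "(\<lambda>n. P (D n) z) sums P (A 0) z"
    using spectral D disj unfolding positive_spectral_measure_def by (metis image_subset_iff)
  then have "(\<lambda>n. \<Sum>i<n. P (D i) z) \<longlonglongrightarrow> P (A 0) z"
    by (simp add: sums_def)
  moreover have "(\<Sum>i<n. P (D i) z) = P (A 0) z - P (A n) z" for n
    by (induction n) (simp_all add: PD blinfun.diff_left)
  ultimately have "(\<lambda>n. P (A 0) z - P (A n) z) \<longlonglongrightarrow> P (A 0) z"
    by simp
  from tendsto_diff[OF tendsto_const[of "P (A 0) z"] this] show ?thesis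
    by simp
qed

lemma rho_monotone_convergence:
  assumes \<phi>: "\<And>n. \<phi> n \<in> bounded_borel" "incseq \<phi>"
    and g: "g \<in> bounded_borel" "\<And>x. (\<lambda>n. \<phi> n x) \<longlonglongrightarrow> g x"
  shows "(\<lambda>n. \<rho> (\<phi> n) z) \<longlonglongrightarrow> \<rho> g z"
proof -
  define \<psi> where "\<psi> n x = g x - \<phi> n x" for n x
  have \<psi>: "\<psi> n \<in> bounded_borel" for n
    unfolding \<psi>_def by (intro bounded_borel_diff g \<phi>)
  have inc: "\<phi> m x \<le> \<phi> n x" if "m \<le> n" for m n x
    using incseqD[OF \<phi>(2) that] by (simp add: le_fun_def)
  have \<psi>_nonneg: "0 \<le> \<psi> n x" for n x
    using incseq_le[OF _ g(2)[of x], of n] inc by (simp add: \<psi>_def incseq_def)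
  \<comment> \<open>The functions \<open>\<psi> n\<close> are nonnegative and decrease, so a bound
    for the first one bounds them all.\<close>
  obtain M where M: "0 < M" "\<And>x. \<bar>\<psi> 0 x\<bar> \<le> M"
    using bounded_borelE[OF \<psi>[of 0]] by blast
  have \<psi>_le: "\<psi> n x \<le> M" for n x
    using inc[of 0 n x] M(2)[of x] by (simp add: \<psi>_def)
  have pos: "(\<lambda>n. \<rho> (\<psi> n) z) \<longlonglongrightarrow> 0" if z: "0 \<le> z" for z
  proof (rule LIMSEQ_I)
    fix r :: real assume r: "0 < r"
    \<comment> \<open>This makes the contribution of the region where \<open>\<psi> n\<close> is
      small less than \<open>r / 2\<close>; the added 1 covers the case
      \<open>P UNIV z = 0\<close>.\<close>
    define e where "e = r / (2 * (norm (P UNIV z) + 1))"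
    have denom: "0 < 2 * (norm (P UNIV z) + 1)"
      by (simp add: add_nonneg_pos)
    have e: "0 < e" "e * norm (P UNIV z) < r / 2"
    proof -
      show "0 < e" using r denom by (simp add: e_def)
      then have "e * norm (P UNIV z) < e * (norm (P UNIV z) + 1)" by simp
      also have "\<dots> = r / 2" using denom by (simp add: e_def field_simps)
      finally show "e * norm (P UNIV z) < r / 2" .
    qed
    define A where "A n = {x. e \<le> \<psi> n x}" for n
    have A: "A n \<in> sets borel" for n
    proof -
      have [measurable]: "\<psi> n \<in> borel_measurable borel"
        using \<psi>[of n] by (simp add: bounded_borel_def)
      show ?thesis unfolding A_def by measurable
    qed
    have "decseq A"
      unfolding decseq_def
    proof (intro allI impI subsetI)
      fix m n x assume "m \<le> n" "x \<in> A n"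
      then show "x \<in> A m"
        using inc[of m n x] by (simp add: A_def \<psi>_def)
    qed
    moreover have "(\<Inter>n. A n) = {}"
    proof -
      have "\<exists>n. x \<notin> A n" for x
      proof -
        have "(\<lambda>n. \<psi> n x) \<longlonglongrightarrow> 0"
          unfolding \<psi>_def using tendsto_diff[OF tendsto_const[of "g x"] g(2)[of x]] by simp
        then have "eventually (\<lambda>n. \<psi> n x < e) sequentially"
          using e(1) by (rule order_tendstoD)
        then show ?thesis
          by (auto simp: A_def eventually_sequentially not_le)
      qed
      then show ?thesis by auto
    qed
    ultimately have "(\<lambda>n. M * norm (P (A n) z)) \<longlonglongrightarrow> M * norm (0 :: 'e)"
      by (intro tendsto_mult tendsto_const tendsto_norm P_decreasing_to_empty A)
    then have "eventually (\<lambda>n. M * norm (P (A n) z) < r / 2) sequentially"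
      using r by (intro order_tendstoD) auto
    moreover have "norm (\<rho> (\<psi> n) z) \<le> M * norm (P (A n) z) + e * norm (P UNIV z)" for n
    proof -
      let ?b = "\<lambda>x. M * indicat_real (A n) x + e * indicat_real UNIV x"
      have b: "?b \<in> bounded_borel"
        by (intro bounded_borel_add bounded_borel_scale bounded_borel_indicator A) simp
      have "\<psi> n \<le> ?b"
        using \<psi>_le[of n] e(1) by (auto simp: le_fun_def A_def indicator_def add_increasing2)
      then have "\<rho> (\<psi> n) z \<le> \<rho> ?b z"
        by (intro rho_mono \<psi> b z)
      also have "\<rho> ?b z = M *\<^sub>R P (A n) z + e *\<^sub>R P UNIV z"
        by (simp only: rho_add rho_scale bounded_borel_scale bounded_borel_indicator rho_indicator A
            sets.top[of borel, unfolded space_borel] blinfun.add_left blinfun.scaleR_left)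
      finally have "norm (\<rho> (\<psi> n) z) \<le> norm (M *\<^sub>R P (A n) z + e *\<^sub>R P UNIV z)"
        by (intro norm_mono_nonneg rho_nonneg \<psi> \<psi>_nonneg z)
      also have "\<dots> \<le> M * norm (P (A n) z) + e * norm (P UNIV z)"
        using norm_triangle_ineq[of "M *\<^sub>R P (A n) z" "e *\<^sub>R P UNIV z"] M(1) e(1) by simp
      finally show ?thesis .
    qed
    ultimately have "eventually (\<lambda>n. norm (\<rho> (\<psi> n) z) < r) sequentially"
      using e(2) by (elim eventually_mono) (smt (verit) field_sum_of_halves)
    then show "\<exists>N. \<forall>n\<ge>N. norm (\<rho> (\<psi> n) z - 0) < r"
      by (simp add: eventually_sequentially)
  qed
  \<comment> \<open>Domination was available only on positive vectors; a general \<open>z\<close> is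
    a difference of two of them.\<close>
  obtain a b where ab: "0 \<le> a" "0 \<le> b" "z = a - b"
    by (rule diff_nonneg_decomposition)
  have "(\<lambda>n. \<rho> (\<psi> n) a - \<rho> (\<psi> n) b) \<longlonglongrightarrow> 0 - 0"
    using ab by (intro tendsto_diff pos)
  moreover have "\<rho> (\<psi> n) a - \<rho> (\<psi> n) b = \<rho> g z - \<rho> (\<phi> n) z" for n
    unfolding \<psi>_def rho_diff[OF g(1) \<phi>(1)] ab(3)
    by (simp add: blinfun.diff_left blinfun.diff_right)
  ultimately have "(\<lambda>n. \<rho> g z - \<rho> (\<phi> n) z) \<longlonglongrightarrow> 0"
    by simp
  from tendsto_diff[OF tendsto_const[of "\<rho> g z"] this] show ?thesis
    by simp
qed

lemma P_regular_operator: "A \<in> sets borel \<Longrightarrow> P A \<in> regular_operators"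
  by (intro positive_operator_regular) (simp add: positive_operator_blinfun P_nonneg)

text \<open>Strong convergence yields the supremum: since the cone is closed, every upper bound of
  the sequence dominates the limit on positive vectors.\<close>

lemma rho_increases_to:
  assumes \<phi>: "\<And>n. \<phi> n \<in> bounded_borel" and V: "V \<in> sets borel"
    and inc: "increases_to_in (\<le>) bounded_borel \<phi> (indicat_real V)"
  shows "increases_to_in operator_le regular_operators (\<lambda>n. \<rho> (\<phi> n)) (P V)"
    and "limitin weak_operator_topology (\<lambda>n. \<rho> (\<phi> n)) (P V) sequentially"
proof -
  note ind = bounded_borel_indicator[OF V]
  have lim: "(\<lambda>n. \<rho> (\<phi> n) z) \<longlonglongrightarrow> P V z" for z
    using rho_monotone_convergence[OF \<phi> increases_to_in_bounded_borelD(1)[OF inc] ind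
      increases_to_in_bounded_borelD(2)[OF inc]]
    by (simp add: rho_indicator V)
  then show "limitin weak_operator_topology (\<lambda>n. \<rho> (\<phi> n)) (P V) sequentially"
    by (rule limitin_weak_operator_topologyI)
  have "\<phi> n \<le> \<phi> (Suc n)" "\<phi> n \<le> indicat_real V" for n
    using inc by (auto simp: increases_to_in_def is_sup_in_def)
  then have "operator_le (\<rho> (\<phi> n)) (\<rho> (\<phi> (Suc n)))" "operator_le (\<rho> (\<phi> n)) (P V)" for n
    using rho_mono[OF \<phi> \<phi>] rho_mono[OF \<phi> ind] by (auto simp: operator_le_iff rho_indicator V)
  moreover have "operator_le (P V) u" if "\<And>n. operator_le (\<rho> (\<phi> n)) u" for u
    using that unfolding operator_le_iff
    by (intro allI impI tendsto_le_banach_lattice[OF lim tendsto_const]) auto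
  ultimately show "increases_to_in operator_le regular_operators (\<lambda>n. \<rho> (\<phi> n)) (P V)"
    using P_regular_operator[OF V] by (auto simp: increases_to_in_def is_sup_in_def)
qed

end

section \<open>Order suprema and infima from regularity\<close>

locale regular_generated_spectral_representation =
  generated_spectral_representation P \<rho>
  for P :: "'a::t2_space set \<Rightarrow> 'e::banach_lattice \<Rightarrow>\<^sub>L 'e" and \<rho> +
  assumes regular: "regular_positive_spectral_measure P"
begin

lemma regular_finite_signed:
  "regular_finite_signed_borel_measure (\<lambda>D. blinfun_apply f (P D z))"
  using regular[unfolded regular_positive_spectral_measure_def, THEN conjunct2, THEN spec, THEN spec,
      of f z] .

lemma P_inner:
  fixes f :: "'e \<Rightarrow>\<^sub>L real"
  assumes "open V" "0 < e"
  obtains K where "compact K" "K \<subseteq> V" "f (P V z) < f (P K z) + e"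
proof -
  obtain K where "compact K" "K \<subseteq> V" "f (P V z) < f (P K z) + e"
    by (rule regular_finite_signed_inner[OF regular_finite_signed[of f z] assms])
  then show thesis by (rule that)
qed

lemma P_outer:
  fixes f :: "'e \<Rightarrow>\<^sub>L real"
  assumes "compact K" "0 < e"
  obtains U where "open U" "K \<subseteq> U" "f (P U z) < f (P K z) + e"
proof -
  obtain U where "open U" "K \<subseteq> U" "f (P U z) < f (P K z) + e"
    by (rule regular_finite_signed_outer[OF regular_finite_signed[of f z]
        borel_compact[OF assms(1)] assms(2)])
  then show thesis by (rule that)
qed

text \<open>The family \<open>S\<close> is left abstract so that compactly supported functions and
  functions vanishing at infinity are treated alike: it must lie below the indicator of
  \<open>V\<close> and dominate that of each compact subset.\<close>

lemma P_open_is_sup: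
  assumes V: "open V"
    and S: "S \<subseteq> bounded_borel" "\<And>\<phi>. \<phi> \<in> S \<Longrightarrow> \<phi> \<le> indicat_real V"
    and K: "\<And>K. compact K \<Longrightarrow> K \<subseteq> V \<Longrightarrow> \<exists>\<phi>\<in>S. indicat_real K \<le> \<phi>"
  shows "is_sup_in operator_le regular_operators (\<rho> ` S) (P V)"
  unfolding is_sup_in_def
proof (intro conjI ballI impI)
  have V': "V \<in> sets borel" using V by simp
  then show "P V \<in> regular_operators" by (rule P_regular_operator)
  show "operator_le T (P V)" if T: "T \<in> \<rho> ` S" for T
  proof -
    obtain \<phi> where "\<phi> \<in> S" "T = \<rho> \<phi>"
      using T by blast
    then show ?thesis
      using rho_mono[OF _ bounded_borel_indicator[OF V'] S(2)] S(1)
      by (auto simp: operator_le_iff rho_indicator V')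
  qed
  show "operator_le (P V) u" if u: "\<forall>T\<in>\<rho> ` S. operator_le T u" for u
  proof (rule operator_leI_functionals)
    fix z :: 'e and f :: "'e \<Rightarrow>\<^sub>L real" and e :: real
    assume z: "0 \<le> z" and f: "\<And>x. 0 \<le> x \<Longrightarrow> 0 \<le> blinfun_apply f x" and e: "0 < e"
    obtain K where K': "compact K" "K \<subseteq> V" "f (P V z) < f (P K z) + e"
      using P_inner[OF V e] by blast
    obtain \<phi> where \<phi>: "\<phi> \<in> S" "indicat_real K \<le> \<phi>"
      using K[OF K'(1,2)] by blast
    have "P K z \<le> \<rho> \<phi> z"
      using rho_mono[OF bounded_borel_indicator _ \<phi>(2) z] \<phi>(1) S(1) borel_compact[OF K'(1)]
      by (auto simp: rho_indicator)
    also have "\<dots> \<le> u z"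
      using u \<phi>(1) z by (auto simp: operator_le_iff)
    finally have "f (P K z) \<le> f (u z)"
      using f by (rule blinfun_monoD[rotated])
    then show "f (P V z) < f (u z) + e"
      using K'(3) by simp
  qed
qed

text \<open>Members of \<open>S\<close> may be large off \<open>K\<close>; it is enough that each
  open \<open>U\<close> around \<open>K\<close> admits one member below its indicator, which puts
  any lower bound under \<open>P U z\<close>.\<close>

lemma P_compact_is_inf:
  assumes K: "compact K"
    and S: "S \<subseteq> bounded_borel" "\<And>\<phi>. \<phi> \<in> S \<Longrightarrow> indicat_real K \<le> \<phi>"
    and U: "\<And>U. open U \<Longrightarrow> K \<subseteq> U \<Longrightarrow> \<exists>\<phi>\<in>S. \<phi> \<le> indicat_real U"
  shows "is_inf_in operator_le regular_operators (\<rho> ` S) (P K)"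
  unfolding is_inf_in_def
proof (intro conjI ballI impI)
  note K' = borel_compact[OF K]
  then show "P K \<in> regular_operators" by (rule P_regular_operator)
  show "operator_le (P K) T" if T: "T \<in> \<rho> ` S" for T
  proof -
    obtain \<phi> where "\<phi> \<in> S" "T = \<rho> \<phi>"
      using T by blast
    then show ?thesis
      using rho_mono[OF bounded_borel_indicator[OF K'] _ S(2)] S(1)
      by (auto simp: operator_le_iff rho_indicator K')
  qed
  show "operator_le u (P K)" if u: "\<forall>T\<in>\<rho> ` S. operator_le u T" for u
  proof (rule operator_leI_functionals)
    fix z :: 'e and f :: "'e \<Rightarrow>\<^sub>L real" and e :: real
    assume z: "0 \<le> z" and f: "\<And>x. 0 \<le> x \<Longrightarrow> 0 \<le> blinfun_apply f x" and e: "0 < e"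
    obtain U where U': "open U" "K \<subseteq> U" "f (P U z) < f (P K z) + e"
      using P_outer[OF K e] by blast
    obtain \<phi> where \<phi>: "\<phi> \<in> S" "\<phi> \<le> indicat_real U"
      using U[OF U'(1,2)] by blast
    have "u z \<le> \<rho> \<phi> z"
      using u \<phi>(1) z by (auto simp: operator_le_iff)
    also have "\<dots> \<le> P U z"
      using rho_mono[OF _ bounded_borel_indicator \<phi>(2) z] \<phi>(1) S(1) U'(1)
      by (auto simp: rho_indicator)
    finally have "f (u z) \<le> f (P U z)"
      using f by (rule blinfun_monoD[rotated])
    then show "f (u z) < f (P K z) + e"
      using U'(3) by simp
  qed
qed

end

theorem theorem5p12:
  fixes \<pi> :: "('a::t2_space \<Rightarrow> real) \<Rightarrow> ('e::banach_lattice \<Rightarrow>\<^sub>L 'e)"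
    and P :: "'a set \<Rightarrow> ('e \<Rightarrow>\<^sub>L 'e)"
  assumes "locally_compact_space (euclidean :: 'a topology)"
    and "positive_representation C0 \<pi>"
    and "\<pi> ` C0 \<subseteq> regular_operators"
    and "regular_positive_spectral_measure P"
    and "generates P \<pi>"
  shows
    "(\<forall>V. open V \<longrightarrow>
        is_sup_in operator_le regular_operators
          (\<pi> ` {\<phi> \<in> Cc. tsupp \<phi> \<subseteq> V \<and> (\<forall>x. 0 \<le> \<phi> x \<and> \<phi> x \<le> 1)}) (P V))
     \<and>
     (\<forall>K. compact K \<longrightarrow>
        is_inf_in operator_le regular_operators
          (\<pi> ` {\<phi> \<in> Cc. \<forall>x. indicat_real K x \<le> \<phi> x}) (P K))
     \<and>
     is_sup_in operator_le regular_operators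
       (\<pi> ` {\<phi> \<in> C0. \<forall>x. 0 \<le> \<phi> x \<and> \<phi> x \<le> 1}) (P UNIV)
     \<and>
     (\<forall>V. open V \<longrightarrow>
        (sigma_compact V \<longleftrightarrow>
           (\<exists>\<phi> :: nat \<Rightarrow> 'a \<Rightarrow> real. (\<forall>n. \<phi> n \<in> Cc \<and> tsupp (\<phi> n) \<subseteq> V) \<and>
              is_sup_in (\<le>) bounded_borel (range \<phi>) (indicat_real V)))
        \<and>
        (sigma_compact V \<longrightarrow>
           (\<exists>\<phi> :: nat \<Rightarrow> 'a \<Rightarrow> real.
              (\<forall>n. \<phi> n \<in> Cc \<and> tsupp (\<phi> n) \<subseteq> V \<and> (\<forall>x. 0 \<le> \<phi> n x \<and> \<phi> n x \<le> 1)) \<and>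
              increases_to_in (\<le>) bounded_borel \<phi> (indicat_real V)))
        \<and>
        (\<forall>\<phi> :: nat \<Rightarrow> 'a \<Rightarrow> real.
           (\<forall>n. \<phi> n \<in> Cc) \<and> norm_bounded_seq \<phi> \<and>
           increases_to_in (\<le>) bounded_borel \<phi> (indicat_real V) \<longrightarrow>
             increases_to_in operator_le regular_operators (\<lambda>n. \<pi> (\<phi> n)) (P V) \<and>
             limitin weak_operator_topology (\<lambda>n. \<pi> (\<phi> n)) (P V) sequentially))
     \<and>
     ((sigma_compact (UNIV :: 'a set) \<longleftrightarrow>
         (\<exists>\<phi> :: nat \<Rightarrow> 'a \<Rightarrow> real. (\<forall>n. \<phi> n \<in> C0 \<and> (\<forall>x. 0 \<le> \<phi> n x \<and> \<phi> n x \<le> 1)) \<and>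
            is_sup_in (\<le>) bounded_borel (range \<phi>) (\<lambda>_. 1)))
      \<and>
      (sigma_compact (UNIV :: 'a set) \<longrightarrow>
         (\<exists>\<phi> :: nat \<Rightarrow> 'a \<Rightarrow> real. (\<forall>n. \<phi> n \<in> Cc \<and> (\<forall>x. 0 \<le> \<phi> n x \<and> \<phi> n x \<le> 1)) \<and>
            increases_to_in (\<le>) bounded_borel \<phi> (\<lambda>_. 1)))
      \<and>
      (\<forall>\<phi> :: nat \<Rightarrow> 'a \<Rightarrow> real.
         (\<forall>n. \<phi> n \<in> C0) \<and> norm_bounded_seq \<phi> \<and>
         increases_to_in (\<le>) bounded_borel \<phi> (\<lambda>_. 1) \<longrightarrow>
           increases_to_in operator_le regular_operators (\<lambda>n. \<pi> (\<phi> n)) (P UNIV) \<and>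
           limitin weak_operator_topology (\<lambda>n. \<pi> (\<phi> n)) (P UNIV) sequentially))"
proof -
  note lc = assms(1)
  obtain \<rho> where \<rho>: "generated_representation P \<rho>" and \<pi>: "\<And>\<phi>. \<phi> \<in> C0 \<Longrightarrow> \<pi> \<phi> = \<rho> \<phi>"
    using assms(5) by (auto simp: generates_def)
  interpret regular_generated_spectral_representation P \<rho>
    using assms(4) \<rho> by unfold_locales (simp_all add: regular_positive_spectral_measure_def)
  have bb: "\<phi> \<in> bounded_borel" if "\<phi> \<in> C0" for \<phi> :: "'a \<Rightarrow> real"
    using that C0_subset_bounded_borel by blast
  have Cc: "\<phi> \<in> C0" if "\<phi> \<in> Cc" for \<phi> :: "'a \<Rightarrow> real"
    using that Cc_subset_C0 by blast
  \<comment> \<open>The maps \<open>\<pi>\<close> and \<open>\<rho>\<close> are known to agree only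
    on \<open>C0\<close>, so the families are transferred as images of subsets of
    \<open>C0\<close>.\<close>
  have image: "\<pi> ` S = \<rho> ` S" if "S \<subseteq> C0" for S
    using that \<pi> by (intro image_cong) auto
  have Urysohn: "\<exists>\<phi>\<in>Cc. tsupp \<phi> \<subseteq> V \<and> (\<forall>x. 0 \<le> \<phi> x \<and> \<phi> x \<le> 1) \<and> indicat_real K \<le> \<phi>"
    if "compact K" "open V" "K \<subseteq> V" for K V :: "'a set"
    using Urysohn_Cc[OF lc that] by (metis indicator_le_iff order_refl)
  \<comment> \<open>Written as an indicator, the constant 1 turns the statements about the whole
    space into the case \<open>V = UNIV\<close>.\<close>
  have UNIV: "(\<lambda>_. 1) = indicat_real (UNIV :: 'a set)"
    by (simp add: fun_eq_iff)

  have sup_open: "is_sup_in operator_le regular_operators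
      (\<pi> ` {\<phi> \<in> Cc. tsupp \<phi> \<subseteq> V \<and> (\<forall>x. 0 \<le> \<phi> x \<and> \<phi> x \<le> 1)}) (P V)" if V: "open V" for V
  proof (subst image)
    let ?S = "{\<phi> \<in> Cc. tsupp \<phi> \<subseteq> V \<and> (\<forall>x. 0 \<le> \<phi> x \<and> \<phi> x \<le> 1)}"
    show "is_sup_in operator_le regular_operators (\<rho> ` ?S) (P V)"
    proof (rule P_open_is_sup[OF V])
      show "\<exists>\<phi>\<in>?S. indicat_real K \<le> \<phi>" if "compact K" "K \<subseteq> V" for K
        using Urysohn[OF that(1) V that(2)] by auto
    qed (auto intro: bb Cc le_indicator_of_tsupp)
  qed (auto intro: Cc)

  have inf_compact: "is_inf_in operator_le regular_operators
      (\<pi> ` {\<phi> \<in> Cc. \<forall>x. indicat_real K x \<le> \<phi> x}) (P K)" if K: "compact K" for K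
  proof (subst image)
    let ?S = "{\<phi> \<in> Cc. \<forall>x. indicat_real K x \<le> \<phi> x}"
    show "is_inf_in operator_le regular_operators (\<rho> ` ?S) (P K)"
    proof (rule P_compact_is_inf[OF K])
      show "\<exists>\<phi>\<in>?S. \<phi> \<le> indicat_real U" if U: "open U" "K \<subseteq> U" for U
      proof -
        obtain \<phi> where "\<phi> \<in> Cc" "tsupp \<phi> \<subseteq> U" "\<And>x. \<phi> x \<le> 1" "indicat_real K \<le> \<phi>"
          using Urysohn[OF K U] by blast
        then show ?thesis
          by (intro bexI[of _ \<phi>] le_indicator_of_tsupp) (auto simp: le_fun_def)
      qed
    qed (auto intro: bb Cc simp: le_fun_def)
  qed (auto intro: Cc)

  have sup_UNIV: "is_sup_in operator_le regular_operators
      (\<pi> ` {\<phi> \<in> C0. \<forall>x. 0 \<le> \<phi> x \<and> \<phi> x \<le> 1}) (P UNIV)"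
  proof (subst image)
    let ?S = "{\<phi> \<in> C0. \<forall>x. 0 \<le> \<phi> x \<and> \<phi> x \<le> 1} :: ('a \<Rightarrow> real) set"
    show "is_sup_in operator_le regular_operators (\<rho> ` ?S) (P UNIV)"
    proof (rule P_open_is_sup)
      show "\<exists>\<phi>\<in>?S. indicat_real K \<le> \<phi>" if "compact K" "K \<subseteq> UNIV" for K
        using Urysohn[OF that(1) open_UNIV that(2)] Cc by blast
    qed (auto intro: bb simp: le_fun_def)
  qed auto

  \<comment> \<open>Stated for \<open>C0\<close>, this covers the sequences in \<open>Cc\<close> for
    open \<open>V\<close> as well as those in \<open>C0\<close> for the whole space.\<close>
  have conv: "increases_to_in operator_le regular_operators (\<lambda>n. \<pi> (\<phi> n)) (P V) \<and>
      limitin weak_operator_topology (\<lambda>n. \<pi> (\<phi> n)) (P V) sequentially"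
    if "open V" "\<And>n. \<phi> n \<in> C0" "increases_to_in (\<le>) bounded_borel \<phi> (indicat_real V)"
    for V and \<phi> :: "nat \<Rightarrow> 'a \<Rightarrow> real"
    using rho_increases_to[of \<phi> V] that by (simp add: \<pi> bb)

  have seq: "\<exists>\<phi> :: nat \<Rightarrow> 'a \<Rightarrow> real.
      (\<forall>n. \<phi> n \<in> Cc \<and> tsupp (\<phi> n) \<subseteq> V \<and> (\<forall>x. 0 \<le> \<phi> n x \<and> \<phi> n x \<le> 1)) \<and>
      increases_to_in (\<le>) bounded_borel \<phi> (indicat_real V)" if "open V" "sigma_compact V" for V
    using sigma_compact_imp_increasing_Cc[OF lc that] by metis

  have sigma: "sigma_compact V"
    if "\<And>n. \<phi> n \<in> C0" "is_sup_in (\<le>) bounded_borel (range \<phi>) (indicat_real V)"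
    for V and \<phi> :: "nat \<Rightarrow> 'a \<Rightarrow> real"
    using sigma_compact_if_is_sup_in that by blast

  show ?thesis
    unfolding UNIV
  proof (intro conjI allI impI iffI)
    fix V :: "'a set" assume V: "open V"
    {
      assume "sigma_compact V"
      then show "\<exists>\<phi> :: nat \<Rightarrow> 'a \<Rightarrow> real. (\<forall>n. \<phi> n \<in> Cc \<and> tsupp (\<phi> n) \<subseteq> V) \<and>
          is_sup_in (\<le>) bounded_borel (range \<phi>) (indicat_real V)"
        using seq[OF V] by (auto simp: increases_to_in_def)
    next
      assume "\<exists>\<phi> :: nat \<Rightarrow> 'a \<Rightarrow> real. (\<forall>n. \<phi> n \<in> Cc \<and> tsupp (\<phi> n) \<subseteq> V) \<and>
          is_sup_in (\<le>) bounded_borel (range \<phi>) (indicat_real V)"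
      then show "sigma_compact V"
        using sigma Cc by blast
    }
  next
    assume "sigma_compact (UNIV :: 'a set)"
    then show "\<exists>\<phi> :: nat \<Rightarrow> 'a \<Rightarrow> real. (\<forall>n. \<phi> n \<in> C0 \<and> (\<forall>x. 0 \<le> \<phi> n x \<and> \<phi> n x \<le> 1)) \<and>
        is_sup_in (\<le>) bounded_borel (range \<phi>) (indicat_real UNIV)"
      using seq[OF open_UNIV] Cc unfolding increases_to_in_def by blast
  next
    assume "\<exists>\<phi> :: nat \<Rightarrow> 'a \<Rightarrow> real. (\<forall>n. \<phi> n \<in> C0 \<and> (\<forall>x. 0 \<le> \<phi> n x \<and> \<phi> n x \<le> 1)) \<and>
        is_sup_in (\<le>) bounded_borel (range \<phi>) (indicat_real UNIV)"
    then show "sigma_compact (UNIV :: 'a set)"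
      using sigma by blast
  next
    assume "sigma_compact (UNIV :: 'a set)"
    then show "\<exists>\<phi> :: nat \<Rightarrow> 'a \<Rightarrow> real. (\<forall>n. \<phi> n \<in> Cc \<and> (\<forall>x. 0 \<le> \<phi> n x \<and> \<phi> n x \<le> 1)) \<and>
        increases_to_in (\<le>) bounded_borel \<phi> (indicat_real UNIV)"
      using seq[OF open_UNIV] by blast
  next
    fix V :: "'a set" and \<phi> :: "nat \<Rightarrow> 'a \<Rightarrow> real"
    assume V: "open V" and \<phi>: "(\<forall>n. \<phi> n \<in> Cc) \<and> norm_bounded_seq \<phi> \<and>
      increases_to_in (\<le>) bounded_borel \<phi> (indicat_real V)"
    then have "\<And>n. \<phi> n \<in> C0"
      using Cc by blast
    with V \<phi> show "increases_to_in operator_le regular_operators (\<lambda>n. \<pi> (\<phi> n)) (P V)"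
      and "limitin weak_operator_topology (\<lambda>n. \<pi> (\<phi> n)) (P V) sequentially"
      using conv[of V \<phi>] by simp_all
  next
    fix \<phi> :: "nat \<Rightarrow> 'a \<Rightarrow> real"
    assume \<phi>: "(\<forall>n. \<phi> n \<in> C0) \<and> norm_bounded_seq \<phi> \<and>
      increases_to_in (\<le>) bounded_borel \<phi> (indicat_real UNIV)"
    then show "increases_to_in operator_le regular_operators (\<lambda>n. \<pi> (\<phi> n)) (P UNIV)"
      and "limitin weak_operator_topology (\<lambda>n. \<pi> (\<phi> n)) (P UNIV) sequentially"
      using conv[OF open_UNIV, of \<phi>] by blast+
  qed (rule sup_open inf_compact sup_UNIV seq; assumption)+
qed

end
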